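(* Let $V$ be a vertex operator algebra of CFT type, with Virasoro vector $\omega$ and $L_n=\omega_{(n+1)}$. Then $\overline{\eta}(L_{-n}\omega)=0$ in $\widetilde{V}/C_2(\widetilde{V})$ for all integers $n\geq 30$. In particular, the subspace of $\widetilde{V}/C_2(\widetilde{V})$ spanned by $\{\overline{\eta}(L_{-n}\omega)\mid n\geq 2\}$ is finite dimensional.
   Context: All vector spaces are over $\mathbb{C}$. A vertex operator algebra $V=\bigoplus_{d=0}^\infty V_d$ has $n$-th products $(a,b)\mapsto a_{(n)}b$ ($n\in\mathbb{Z}$), vacuum vector $\mathbf{1}\in V_0$ and Virasoro vector $\omega\in V_2$. $V$ is of CFT type if $V_0=\mathbb{C}\mathbf{1}$. The central charge of $V$ is arbitrary. For a vertex operator algebra $W$, $C_2(W)$ is the span of $\{a_{(-2)}b\mid a,b\in W\}$. $V\otimes V$ is the tensor product vertex operator algebra, with vacuum $\mathbf{1}\otimes\mathbf{1}$, Virasoro vector $\omega\otimes\mathbf{1}+\mathbf{1}\otimes\omega$ and products $(a\otimes b)_{(n)}(u\otimes v)=\sum_{i\in\mathbb{Z}}(a_{(i)}u)\otimes(b_{(n-1-i)}v)$. The map $\sigma(a\otimes b)=b\otimes a$ is an automorphism of $V\otimes V$, and $\widetilde{V}:=(V\otimes V)^\sigma$ is the vertex operator subalgebra of $\sigma$-fixed points. For $a\in V$, $\eta(a)=a\otimes\mathbf{1}+\mathbf{1}\otimes a\in\widetilde{V}$, and $\overline{\eta}(a)$ is the image of $\eta(a)$ in $\widetilde{V}/C_2(\widetilde{V})$.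 *)

theory Defs
  imports Complex_Main "HOL-Library.Poly_Mapping" "HOL-Library.Set_Algebras"
begin

section \<open>Complex vector spaces\<close>

class complex_vector = ab_group_add +
  fixes scaleC :: "complex \<Rightarrow> 'a \<Rightarrow> 'a" (infixr \<open>*\<^sub>C\<close> 75)
  assumes scaleC_add_right: "c *\<^sub>C (x + y) = c *\<^sub>C x + c *\<^sub>C y"
    and scaleC_add_left: "(c + d) *\<^sub>C x = c *\<^sub>C x + d *\<^sub>C x"
    and scaleC_scaleC: "c *\<^sub>C (d *\<^sub>C x) = (c * d) *\<^sub>C x"
    and scaleC_one: "1 *\<^sub>C x = x"

global_interpretation cvec: vector_space "scaleC :: complex \<Rightarrow> 'a \<Rightarrow> 'a::complex_vector"
  by unfold_locales (auto simp: scaleC_add_right scaleC_add_left scaleC_scaleC scaleC_one)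

abbreviation clinear :: "('a::complex_vector \<Rightarrow> 'b::complex_vector) \<Rightarrow> bool" where
  "clinear \<equiv> Vector_Spaces.linear scaleC scaleC"

lemma clinear_iff:
  "clinear f \<longleftrightarrow> (\<forall>x y. f (x + y) = f x + f y) \<and> (\<forall>c x. f (c *\<^sub>C x) = c *\<^sub>C f x)"
  by (auto simp: Vector_Spaces.linear_iff cvec.vector_space_axioms)

definition cbilinear :: "('a::complex_vector \<Rightarrow> 'b::complex_vector \<Rightarrow> 'c::complex_vector) \<Rightarrow> bool" where
  "cbilinear f \<longleftrightarrow> (\<forall>a. clinear (f a)) \<and> (\<forall>b. clinear (\<lambda>a. f a b))"

lemma cbilinearI:
  assumes "\<And>a x y. f a (x + y) = f a x + f a y" "\<And>a c x. f a (c *\<^sub>C x) = c *\<^sub>C f a x"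
    "\<And>b x y. f (x + y) b = f x b + f y b" "\<And>b c x. f (c *\<^sub>C x) b = c *\<^sub>C f x b"
  shows "cbilinear f"
  using assms by (auto simp: cbilinear_def clinear_iff)

lemma cbilinearD:
  assumes "cbilinear f"
  shows "f a (x + y) = f a x + f a y" "f a (c *\<^sub>C x) = c *\<^sub>C f a x"
    "f (x' + y') b = f x' b + f y' b" "f (c *\<^sub>C x') b = c *\<^sub>C f x' b"
    "f 0 b = 0" "f a 0 = 0"
proof -
  show *: "f a (x + y) = f a x + f a y" "f a (c *\<^sub>C x) = c *\<^sub>C f a x"
    "f (x' + y') b = f x' b + f y' b" "f (c *\<^sub>C x') b = c *\<^sub>C f x' b" for a b c x y x' y'
    using assms by (auto simp: cbilinear_def clinear_iff)
  show "f 0 b = 0" using *(4)[of 0 0 b] by simp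
  show "f a 0 = 0" using *(2)[of a 0 0] by simp
qed

section \<open>The tensor product of complex vector spaces\<close>

instantiation poly_mapping :: (type, complex_vector) complex_vector
begin

lift_definition scaleC_poly_mapping :: "complex \<Rightarrow> ('a \<Rightarrow>\<^sub>0 'b) \<Rightarrow> 'a \<Rightarrow>\<^sub>0 'b"
  is "\<lambda>c f k. c *\<^sub>C f k"
  by (erule finite_subset[rotated]) auto

instance
  by standard (transfer; simp add: fun_eq_iff scaleC_add_right scaleC_add_left scaleC_scaleC scaleC_one)+

end

instantiation complex :: complex_vector
begin

definition scaleC_complex :: "complex \<Rightarrow> complex \<Rightarrow> complex" where
  "scaleC_complex = (*)"

instance
  by standard (simp_all add: scaleC_complex_def algebra_simps)

end

text \<open>The free vector space on \<^typ>\<open>'a \<times> 'b\<close> is divided by the span of the bilinearity relations.\<close>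

definition tensor_relators ::
    "('a::complex_vector \<times> 'b::complex_vector \<Rightarrow>\<^sub>0 complex) set" where
  "tensor_relators =
     {Poly_Mapping.single (a + a', b) 1 - Poly_Mapping.single (a, b) 1
        - Poly_Mapping.single (a', b) 1 | a a' b. True} \<union>
     {Poly_Mapping.single (a, b + b') 1 - Poly_Mapping.single (a, b) 1
        - Poly_Mapping.single (a, b') 1 | a b b'. True} \<union>
     {Poly_Mapping.single (c *\<^sub>C a, b) 1 - c *\<^sub>C Poly_Mapping.single (a, b) 1 | a b c. True} \<union>
     {Poly_Mapping.single (a, c *\<^sub>C b) 1 - c *\<^sub>C Poly_Mapping.single (a, b) 1 | a b c. True}"

definition tensor_rel ::
    "('a::complex_vector \<times> 'b::complex_vector \<Rightarrow>\<^sub>0 complex) \<Rightarrow> ('a \<times> 'b \<Rightarrow>\<^sub>0 complex) \<Rightarrow> bool" where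
  "tensor_rel x y \<longleftrightarrow> x - y \<in> cvec.span tensor_relators"

lemma equivp_tensor_rel: "equivp tensor_rel"
proof (rule equivpI)
  show "reflp tensor_rel" by (simp add: reflp_def tensor_rel_def cvec.span_zero)
  show "symp tensor_rel"
    by (auto simp: symp_def tensor_rel_def dest: cvec.span_neg)
  show "transp tensor_rel"
    by (auto simp: transp_def tensor_rel_def dest: cvec.span_add)
qed

quotient_type (overloaded) ('a, 'b) tensor =
    "('a::complex_vector \<times> 'b::complex_vector) \<Rightarrow>\<^sub>0 complex" / tensor_rel
  by (rule equivp_tensor_rel)

instantiation tensor :: (complex_vector, complex_vector) complex_vector
begin

lift_definition zero_tensor :: "('a, 'b) tensor" is 0 .

lift_definition plus_tensor :: "('a, 'b) tensor \<Rightarrow> ('a, 'b) tensor \<Rightarrow> ('a, 'b) tensor" is "(+)"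
  unfolding tensor_rel_def by (metis add_diff_add cvec.span_add)

lift_definition uminus_tensor :: "('a, 'b) tensor \<Rightarrow> ('a, 'b) tensor" is uminus
  unfolding tensor_rel_def by (metis cvec.span_neg minus_diff_minus)

lift_definition minus_tensor :: "('a, 'b) tensor \<Rightarrow> ('a, 'b) tensor \<Rightarrow> ('a, 'b) tensor" is "(-)"
proof -
  fix x x' y y' :: "'a \<times> 'b \<Rightarrow>\<^sub>0 complex"
  assume "tensor_rel x x'" "tensor_rel y y'"
  then have "(x - x') - (y - y') \<in> cvec.span tensor_relators"
    unfolding tensor_rel_def by (rule cvec.span_diff)
  also have "(x - x') - (y - y') = (x - y) - (x' - y')" by simp
  finally show "tensor_rel (x - y) (x' - y')" unfolding tensor_rel_def .
qed

lift_definition scaleC_tensor :: "complex \<Rightarrow> ('a, 'b) tensor \<Rightarrow> ('a, 'b) tensor" is scaleC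
  unfolding tensor_rel_def by (metis cvec.scale_right_diff_distrib cvec.span_scale)

instance
proof
  fix x y z :: "('a, 'b) tensor" and c d :: complex
  note [simp] = tensor_rel_def cvec.span_zero
  show "x + y + z = x + (y + z)" by transfer (simp add: add.assoc)
  show "x + y = y + x" by transfer (simp add: add.commute)
  show "0 + x = x" by transfer simp
  show "- x + x = 0" by transfer simp
  show "x - y = x + - y" by transfer simp
  show "c *\<^sub>C (x + y) = c *\<^sub>C x + c *\<^sub>C y" by transfer (simp add: scaleC_add_right)
  show "(c + d) *\<^sub>C x = c *\<^sub>C x + d *\<^sub>C x" by transfer (simp add: scaleC_add_left)
  show "c *\<^sub>C d *\<^sub>C x = (c * d) *\<^sub>C x" by transfer (simp add: scaleC_scaleC)
  show "1 *\<^sub>C x = x" by transfer (simp add: scaleC_one)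
qed

end

lift_definition tens :: "'a::complex_vector \<Rightarrow> 'b::complex_vector \<Rightarrow> ('a, 'b) tensor"
    (infixr \<open>\<otimes>\<close> 72)
  is "\<lambda>a b. Poly_Mapping.single (a, b) 1" .

lemma tensor_relators:
  "Poly_Mapping.single (a + a', b) 1 - (Poly_Mapping.single (a, b) 1 + Poly_Mapping.single (a', b) 1)
     \<in> tensor_relators"
  "Poly_Mapping.single (a, b + b') 1 - (Poly_Mapping.single (a, b) 1 + Poly_Mapping.single (a, b') 1)
     \<in> tensor_relators"
  "Poly_Mapping.single (c *\<^sub>C a, b) 1 - c *\<^sub>C Poly_Mapping.single (a, b) 1 \<in> tensor_relators"
  "Poly_Mapping.single (a, c *\<^sub>C b) 1 - c *\<^sub>C Poly_Mapping.single (a, b) 1 \<in> tensor_relators"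
  unfolding tensor_relators_def diff_diff_eq[symmetric] Un_iff mem_Collect_eq by metis+

lemma cbilinear_tens: "cbilinear tens"
proof (rule cbilinearI)
  fix a a' :: 'a and b b' :: 'b and c :: complex
  show "a \<otimes> (b + b') = a \<otimes> b + a \<otimes> b'"
    by transfer (simp only: tensor_rel_def cvec.span_base[OF tensor_relators(2)])
  show "(a + a') \<otimes> b = a \<otimes> b + a' \<otimes> b"
    by transfer (simp only: tensor_rel_def cvec.span_base[OF tensor_relators(1)])
  show "a \<otimes> (c *\<^sub>C b) = c *\<^sub>C (a \<otimes> b)"
    by transfer (simp only: tensor_rel_def cvec.span_base[OF tensor_relators(4)])
  show "(c *\<^sub>C a) \<otimes> b = c *\<^sub>C (a \<otimes> b)"
    by transfer (simp only: tensor_rel_def cvec.span_base[OF tensor_relators(3)])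
qed

lemma poly_mapping_single_induct [case_names zero add]:
  fixes p :: "'k \<Rightarrow>\<^sub>0 complex"
  assumes "P 0" "\<And>k c p. P p \<Longrightarrow> P (c *\<^sub>C Poly_Mapping.single k 1 + p)"
  shows "P p"
proof (induction p rule: update_induct)
  case const
  show ?case using assms(1) by simp
next
  case (update f a b)
  have "Poly_Mapping.update a b f = b *\<^sub>C Poly_Mapping.single a 1 + f"
    using update(1)
    by (intro poly_mapping_eqI)
       (auto simp: lookup_update lookup_add scaleC_poly_mapping.rep_eq lookup_single when_def
         scaleC_complex_def in_keys_iff)
  then show ?case using assms(2)[OF update(3)] by simp
qed

lemma tensor_induct [case_names zero add]:
  fixes t :: "('a::complex_vector, 'b::complex_vector) tensor"
  assumes "P 0" "\<And>a b t. P t \<Longrightarrow> P (a \<otimes> b + t)"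
  shows "P t"
proof -
  have step: "P (abs_tensor p)" for p :: "'a \<times> 'b \<Rightarrow>\<^sub>0 complex"
  proof (induction p rule: poly_mapping_single_induct)
    case zero
    show ?case using assms(1) by (simp add: zero_tensor.abs_eq)
  next
    case (add k c p)
    have "abs_tensor (c *\<^sub>C Poly_Mapping.single k 1 + p)
        = c *\<^sub>C (fst k \<otimes> snd k) + abs_tensor p"
      by (simp add: plus_tensor.abs_eq scaleC_tensor.abs_eq tens.abs_eq)
    also have "\<dots> = (c *\<^sub>C fst k) \<otimes> snd k + abs_tensor p"
      by (simp add: cbilinearD[OF cbilinear_tens])
    finally show ?case using assms(2)[OF add] by simp
  qed
  show ?thesis using step[of "rep_tensor t"]
    by (simp add: Quotient3_abs_rep[OF Quotient3_tensor])
qed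

lemma tensor_linear_eqI:
  assumes "clinear g" "clinear h" "\<And>a b. g (a \<otimes> b) = h (a \<otimes> b)"
  shows "g = h"
proof
  fix t
  have "g 0 = 0" "h 0 = 0"
    using assms(1,2) by (auto simp: clinear_iff) (metis add_cancel_right_right)+
  then show "g t = h t"
    by (induction t rule: tensor_induct) (use assms in \<open>auto simp: clinear_iff\<close>)
qed

text \<open>The linear map out of the tensor product induced by a bilinear map; it is only
  meaningful for bilinear arguments.\<close>

definition tensor_lift ::
    "('a::complex_vector \<Rightarrow> 'b::complex_vector \<Rightarrow> 'c::complex_vector) \<Rightarrow> ('a, 'b) tensor \<Rightarrow> 'c" where
  "tensor_lift f = (THE g. clinear g \<and> (\<forall>a b. g (a \<otimes> b) = f a b))"

lemma tensor_universal:
  fixes f :: "'a::complex_vector \<Rightarrow> 'b::complex_vector \<Rightarrow> 'c::complex_vector"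
  assumes f: "cbilinear f"
  shows "\<exists>!g. clinear g \<and> (\<forall>a b. g (a \<otimes> b) = f a b)"
proof -
  define F :: "('a \<times> 'b \<Rightarrow>\<^sub>0 complex) \<Rightarrow> 'c" where
    "F p = Sum_any (\<lambda>k. Poly_Mapping.lookup p k *\<^sub>C f (fst k) (snd k))" for p
  have fin: "finite {k. Poly_Mapping.lookup p k *\<^sub>C f (fst k) (snd k) \<noteq> 0}" for p
    by (rule finite_subset[OF _ finite_lookup[of p]]) auto
  have F_add: "F (p + q) = F p + F q" for p q
    unfolding F_def by (simp add: lookup_add scaleC_add_left Sum_any.distrib[OF fin fin])
  have F_scale: "F (c *\<^sub>C p) = c *\<^sub>C F p" for c p
  proof -
    have "F p = (\<Sum>k\<in>Poly_Mapping.keys p. Poly_Mapping.lookup p k *\<^sub>C f (fst k) (snd k))"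
      unfolding F_def by (rule Sum_any.expand_superset) (auto simp: in_keys_iff)
    moreover have "F (c *\<^sub>C p) = (\<Sum>k\<in>Poly_Mapping.keys p. (c * Poly_Mapping.lookup p k) *\<^sub>C f (fst k) (snd k))"
      unfolding F_def scaleC_poly_mapping.rep_eq scaleC_complex_def
      by (rule Sum_any.expand_superset) (auto simp: in_keys_iff)
    ultimately show ?thesis by (simp add: cvec.scale_sum_right scaleC_scaleC)
  qed
  have linF: "clinear F" using F_add F_scale by (simp add: clinear_iff)
  have F_diff: "F (p - q) = F p - F q" for p q
    using F_add[of "p - q" q] by simp
  have F_single: "F (Poly_Mapping.single (a, b) 1) = f a b" for a b
  proof -
    have "F (Poly_Mapping.single (a, b) 1)
        = (\<Sum>k\<in>{(a, b)}. Poly_Mapping.lookup (Poly_Mapping.single (a, b) 1) k *\<^sub>C f (fst k) (snd k))"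
      unfolding F_def by (rule Sum_any.expand_superset) (auto simp: lookup_single when_def split: if_splits)
    then show ?thesis by (simp add: scaleC_one)
  qed
  have "F p = 0" if "p \<in> tensor_relators" for p
    using that by (auto simp: tensor_relators_def F_diff F_single F_scale cbilinearD[OF f])
  then have "tensor_relators \<subseteq> {p. F p = 0}" by auto
  moreover have "cvec.subspace {p. F p = 0}"
    using F_add F_scale F_scale[of 0 0] by (auto simp: cvec.subspace_def)
  ultimately have ker: "cvec.span tensor_relators \<subseteq> {p. F p = 0}"
    by (rule cvec.span_minimal)
  then have F_eq: "F p = F q" if "tensor_rel p q" for p q
    using that F_diff[of p q] by (auto simp: tensor_rel_def)
  define g where "g t = F (rep_tensor t)" for t
  have g_abs: "g (abs_tensor p) = F p" for p
    unfolding g_def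
    by (rule F_eq, rule Quotient3_rep_abs[OF Quotient3_tensor])
       (simp add: tensor_rel_def cvec.span_zero)
  have g_lin: "clinear g"
    unfolding clinear_iff
  proof (intro conjI allI)
    fix x y :: "('a, 'b) tensor" and c
    obtain p q where pq: "x = abs_tensor p" "y = abs_tensor q"
      by (metis Quotient3_abs_rep[OF Quotient3_tensor])
    show "g (x + y) = g x + g y" by (simp add: pq plus_tensor.abs_eq g_abs F_add)
    show "g (c *\<^sub>C x) = c *\<^sub>C g x" by (simp add: pq scaleC_tensor.abs_eq g_abs F_scale)
  qed
  show ?thesis
  proof (rule ex1I[of _ g])
    show "clinear g \<and> (\<forall>a b. g (a \<otimes> b) = f a b)"
      using g_lin by (simp add: tens.abs_eq g_abs F_single)
    then show "h = g" if "clinear h \<and> (\<forall>a b. h (a \<otimes> b) = f a b)" for h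
      using that by (intro tensor_linear_eqI) auto
  qed
qed

lemma
  assumes "cbilinear f"
  shows clinear_tensor_lift: "clinear (tensor_lift f)"
    and tensor_lift_tens: "tensor_lift f (a \<otimes> b) = f a b"
  using theI'[OF tensor_universal[OF assms]] by (auto simp: tensor_lift_def)

section \<open>Quotients of vector spaces\<close>

text \<open>For subspaces \<open>C \<subseteq> W\<close>, the elements of \<open>W / C\<close> are the cosets \<open>w +o C\<close>; the zero vector is
  \<open>C\<close> itself and the sum of two cosets is their Minkowski sum.\<close>

definition quot :: "'a::complex_vector set \<Rightarrow> 'a set \<Rightarrow> 'a set set" where
  "quot W C = (\<lambda>w. w +o C) ` W"

text \<open>Adding \<open>C\<close> only matters for the scalar \<open>0\<close>.\<close>

definition quot_scale :: "'a::complex_vector set \<Rightarrow> complex \<Rightarrow> 'a set \<Rightarrow> 'a set" where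
  "quot_scale C c A = scaleC c ` A + C"

lemma coset_add:
  assumes "cvec.subspace C"
  shows "(x +o C) + (y +o C) = (x + y) +o C"
proof -
  have "C + C = C"
    using assms by (auto simp: set_plus_def cvec.subspace_def intro: exI[of _ 0])
       (metis add.right_neutral)
  then show ?thesis by (simp add: set_plus_rearrange)
qed

lemma coset_scale:
  assumes "cvec.subspace C"
  shows "quot_scale C c (x +o C) = (c *\<^sub>C x) +o C"
proof (intro set_eqI iffI)
  fix z assume "z \<in> quot_scale C c (x +o C)"
  then obtain u v where "u \<in> C" "v \<in> C" "z = c *\<^sub>C (x + u) + v"
    by (auto simp: quot_scale_def set_plus_def elt_set_plus_def)
  then have "z = c *\<^sub>C x + (c *\<^sub>C u + v)" "c *\<^sub>C u + v \<in> C"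
    using assms by (auto simp: scaleC_add_right add.assoc cvec.subspace_def)
  then show "z \<in> (c *\<^sub>C x) +o C" by (auto simp: elt_set_plus_def)
next
  fix z assume "z \<in> (c *\<^sub>C x) +o C"
  then obtain v where "v \<in> C" "z = c *\<^sub>C (x + 0) + v" by (auto simp: elt_set_plus_def)
  moreover have "0 \<in> C" using assms by (simp add: cvec.subspace_def)
  ultimately show "z \<in> quot_scale C c (x +o C)"
    unfolding quot_scale_def set_plus_def elt_set_plus_def by blast
qed

lemma coset_eq_iff:
  assumes "cvec.subspace C"
  shows "x +o C = y +o C \<longleftrightarrow> x - y \<in> C"
proof
  assume "x +o C = y +o C"
  moreover have "x \<in> x +o C" using cvec.subspace_0[OF assms] by (auto simp: elt_set_plus_def)
  ultimately show "x - y \<in> C" by (auto simp: elt_set_plus_def)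
next
  assume *: "x - y \<in> C"
  have "x + u = y + ((x - y) + u)" "y + u = x + (u - (x - y))" for u by simp_all
  then show "x +o C = y +o C"
    using cvec.subspace_add[OF assms *] cvec.subspace_diff[OF assms _ *]
    unfolding elt_set_plus_def by blast
qed

definition quot_subspace :: "'a::complex_vector set \<Rightarrow> 'a set \<Rightarrow> 'a set set \<Rightarrow> bool" where
  "quot_subspace W C U \<longleftrightarrow> U \<subseteq> quot W C \<and> C \<in> U \<and>
     (\<forall>A\<in>U. \<forall>B\<in>U. A + B \<in> U) \<and> (\<forall>c. \<forall>A\<in>U. quot_scale C c A \<in> U)"

definition quot_span :: "'a::complex_vector set \<Rightarrow> 'a set \<Rightarrow> 'a set set \<Rightarrow> 'a set set" where
  "quot_span W C S = quot_subspace W C hull S"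

definition quot_finite_dimensional ::
    "'a::complex_vector set \<Rightarrow> 'a set \<Rightarrow> 'a set set \<Rightarrow> bool" where
  "quot_finite_dimensional W C U \<longleftrightarrow> (\<exists>B. finite B \<and> B \<subseteq> U \<and> quot_span W C B = U)"

lemma quot_subspace_quot:
  assumes "cvec.subspace W" "cvec.subspace C"
  shows "quot_subspace W C (quot W C)"
proof -
  have "C = 0 +o C" by simp
  moreover have "0 \<in> W" using assms(1) by (rule cvec.subspace_0)
  ultimately have "C \<in> quot W C" unfolding quot_def by blast
  with assms show ?thesis
    by (auto simp: quot_subspace_def quot_def coset_add coset_scale cvec.subspace_add
        cvec.subspace_scale)
qed

lemma quot_subspace_quot_span:
  assumes "cvec.subspace W" "cvec.subspace C" "S \<subseteq> quot W C"
  shows "quot_subspace W C (quot_span W C S)"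
proof -
  have "quot_span W C S \<subseteq> quot W C"
    unfolding quot_span_def hull_def using assms(3) quot_subspace_quot[OF assms(1,2)] by blast
  then show ?thesis
    unfolding quot_subspace_def quot_span_def hull_def by blast
qed

section \<open>Vertex operator algebras\<close>

text \<open>\<open>prd a n b\<close> is the \<open>n\<close>-th product of \<open>a\<close> and \<open>b\<close>. By \<open>truncation\<close>, both
  sums in the Borcherds identity have only finitely many nonzero terms.\<close>

locale vertex_algebra =
  fixes prd :: "'a::complex_vector \<Rightarrow> int \<Rightarrow> 'a \<Rightarrow> 'a"
    and vac :: 'a
  assumes bilinear: "cbilinear (\<lambda>a b. prd a n b)"
    and truncation: "\<exists>N. \<forall>n\<ge>N. prd a n b = 0"
    and vacuum: "prd vac n a = (if n = -1 then a else 0)"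
    and creation: "prd a (-1) vac = a" "n \<ge> 0 \<Longrightarrow> prd a n vac = 0"
    and borcherds:
      "Sum_any (\<lambda>i::nat. (of_int p gchoose i) *\<^sub>C prd (prd a (r + int i) b) (p + q - int i) c) =
       Sum_any (\<lambda>i::nat. ((-1) ^ i * (of_int r gchoose i)) *\<^sub>C
         (prd a (p + r - int i) (prd b (q + int i) c)
          - ((-1) powi r) *\<^sub>C prd b (q + r - int i) (prd a (p + int i) c)))"

definition virasoro :: "('a \<Rightarrow> int \<Rightarrow> 'a \<Rightarrow> 'a) \<Rightarrow> 'a \<Rightarrow> int \<Rightarrow> 'a \<Rightarrow> 'a" where
  "virasoro prd \<omega> n a = prd \<omega> (n + 1) a"

locale vertex_operator_algebra = vertex_algebra prd vac
  for prd :: "'a::complex_vector \<Rightarrow> int \<Rightarrow> 'a \<Rightarrow> 'a" and vac :: 'a +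
  fixes \<omega> :: 'a
    and grade :: "nat \<Rightarrow> 'a set"
    and central_charge :: complex
  assumes grade_subspace: "cvec.subspace (grade d)"
    and grade_finite_dimensional: "\<exists>B. finite B \<and> grade d = cvec.span B"
    and grade_direct_sum:
      "\<exists>!v. (\<forall>d. v d \<in> grade d) \<and> finite {d. v d \<noteq> 0} \<and> a = Sum_any v"
    and vac_grade: "vac \<in> grade 0"
    and conformal_grade: "\<omega> \<in> grade 2"
    and virasoro_commutator:
      "virasoro prd \<omega> m (virasoro prd \<omega> n a) - virasoro prd \<omega> n (virasoro prd \<omega> m a) =
         of_int (m - n) *\<^sub>C virasoro prd \<omega> (m + n) a
         + (if m + n = 0 then ((of_int m ^ 3 - of_int m) / 12 * central_charge) *\<^sub>C a else 0)"
    and virasoro_0: "a \<in> grade d \<Longrightarrow> virasoro prd \<omega> 0 a = of_nat d *\<^sub>C a"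
    and virasoro_minus_1: "prd (virasoro prd \<omega> (-1) a) n b = (- of_int n) *\<^sub>C prd a (n - 1) b"

locale cft_type_voa = vertex_operator_algebra +
  assumes cft_type: "grade 0 = cvec.span {vac}"

text \<open>\<open>C\<^sub>2(W)\<close> for a subalgebra with underlying set \<open>W\<close>.\<close>

definition C2 :: "('a \<Rightarrow> int \<Rightarrow> 'a \<Rightarrow> 'a) \<Rightarrow> 'a::complex_vector set \<Rightarrow> 'a set" where
  "C2 prd W = cvec.span {prd a (-2) b | a b. a \<in> W \<and> b \<in> W}"

section \<open>The tensor square and its fixed-point subalgebra\<close>

definition tensor_prd ::
    "('a::complex_vector \<Rightarrow> int \<Rightarrow> 'a \<Rightarrow> 'a) \<Rightarrow> ('a, 'a) tensor \<Rightarrow> int \<Rightarrow> ('a, 'a) tensor \<Rightarrow> ('a, 'a) tensor" where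
  "tensor_prd prd x n y =
     tensor_lift (\<lambda>a b. tensor_lift (\<lambda>u v.
       Sum_any (\<lambda>i. prd a i u \<otimes> prd b (n - 1 - i) v)) y) x"

definition swap :: "('a::complex_vector, 'a) tensor \<Rightarrow> ('a, 'a) tensor" where
  "swap = tensor_lift (\<lambda>a b. b \<otimes> a)"

definition fixed_subalgebra :: "('a::complex_vector, 'a) tensor set" where
  "fixed_subalgebra = {x. swap x = x}"

definition eta :: "'a::complex_vector \<Rightarrow> 'a \<Rightarrow> ('a, 'a) tensor" where
  "eta vac a = a \<otimes> vac + vac \<otimes> a"

abbreviation fixed_C2 ::
    "('a::complex_vector \<Rightarrow> int \<Rightarrow> 'a \<Rightarrow> 'a) \<Rightarrow> ('a, 'a) tensor set" where
  "fixed_C2 prd \<equiv> C2 (tensor_prd prd) fixed_subalgebra"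

definition eta_bar ::
    "('a::complex_vector \<Rightarrow> int \<Rightarrow> 'a \<Rightarrow> 'a) \<Rightarrow> 'a \<Rightarrow> 'a \<Rightarrow> ('a, 'a) tensor set" where
  "eta_bar prd vac a = eta vac a +o fixed_C2 prd"

lemma cbilinear_flip: "cbilinear (\<lambda>a b. b \<otimes> a)"
  by (rule cbilinearI) (simp_all add: cbilinearD[OF cbilinear_tens])

lemma swap_tens: "swap (a \<otimes> b) = b \<otimes> a"
  unfolding swap_def by (rule tensor_lift_tens[OF cbilinear_flip])

lemma swap_add: "swap (x + y) = swap x + swap y"
  and swap_scale: "swap (c *\<^sub>C x) = c *\<^sub>C swap x"
  using clinear_tensor_lift[OF cbilinear_flip] unfolding swap_def clinear_iff by blast+

lemma swap_zero: "swap 0 = 0"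
  using swap_scale[of 0 0] by simp

lemma eta_fixed: "eta vac a \<in> fixed_subalgebra"
  by (simp add: fixed_subalgebra_def eta_def swap_add swap_tens add.commute)

lemma subspace_fixed_subalgebra: "cvec.subspace fixed_subalgebra"
  by (simp add: cvec.subspace_def fixed_subalgebra_def swap_add swap_scale swap_zero)

context vertex_algebra
begin

lemma finite_tensor_terms: "finite {i. prd a i u \<otimes> prd b (n - 1 - i) v \<noteq> 0}"
proof -
  obtain N M where N: "\<And>i. i \<ge> N \<Longrightarrow> prd a i u = 0" and M: "\<And>i. i \<ge> M \<Longrightarrow> prd b i v = 0"
    using truncation by metis
  have "{i. prd a i u \<otimes> prd b (n - 1 - i) v \<noteq> 0} \<subseteq> {n - 1 - M..N}"
  proof
    fix i assume "i \<in> {i. prd a i u \<otimes> prd b (n - 1 - i) v \<noteq> 0}"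
    then have "prd a i u \<noteq> 0" "prd b (n - 1 - i) v \<noteq> 0"
      by (auto simp: cbilinearD[OF cbilinear_tens])
    then have "\<not> i \<ge> N" "\<not> n - 1 - i \<ge> M" using N M by blast+
    then show "i \<in> {n - 1 - M..N}" by auto
  qed
  then show ?thesis by (rule finite_subset) simp
qed

lemma Sum_any_scale:
  fixes f :: "int \<Rightarrow> ('a, 'a) tensor"
  assumes "finite {i. f i \<noteq> 0}"
  shows "Sum_any (\<lambda>i. c *\<^sub>C f i) = c *\<^sub>C Sum_any f"
proof -
  have "Sum_any (\<lambda>i. c *\<^sub>C f i) = (\<Sum>i\<in>{i. f i \<noteq> 0}. c *\<^sub>C f i)"
    by (rule Sum_any.expand_superset[OF assms]) auto
  then show ?thesis by (simp add: Sum_any.expand_set cvec.scale_sum_right)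
qed

lemma tensor_prd_bilinear_inner:
  "cbilinear (\<lambda>u v. Sum_any (\<lambda>i. prd a i u \<otimes> prd b (n - 1 - i) v))"
  by (rule cbilinearI)
     (simp_all add: cbilinearD[OF bilinear] cbilinearD[OF cbilinear_tens]
       Sum_any_scale finite_tensor_terms Sum_any.distrib)

lemma tensor_prd_bilinear_outer:
  "cbilinear (\<lambda>a b. tensor_lift (\<lambda>u v. Sum_any (\<lambda>i. prd a i u \<otimes> prd b (n - 1 - i) v)) y)"
proof -
  define G where "G a b = tensor_lift (\<lambda>u v. Sum_any (\<lambda>i. prd a i u \<otimes> prd b (n - 1 - i) v))" for a b
  have lin: "G a b (x + y) = G a b x + G a b y" "G a b (c *\<^sub>C x) = c *\<^sub>C G a b x"
    for a b x y c
    using clinear_tensor_lift[OF tensor_prd_bilinear_inner] unfolding G_def clinear_iff by blast+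
  have G0: "G a b 0 = 0" for a b using lin(2)[of a b 0 0] by simp
  have tens: "G a b (u \<otimes> v) = Sum_any (\<lambda>i. prd a i u \<otimes> prd b (n - 1 - i) v)" for a b u v
    unfolding G_def by (rule tensor_lift_tens[OF tensor_prd_bilinear_inner])
  have 1: "G a (x + x') y = G a x y + G a x' y" for a x x'
    by (induction y rule: tensor_induct)
       (simp_all add: G0 lin tens cbilinearD[OF bilinear] cbilinearD[OF cbilinear_tens]
         Sum_any_scale finite_tensor_terms Sum_any.distrib ac_simps)
  have 2: "G (x + x') a y = G x a y + G x' a y" for a x x'
    by (induction y rule: tensor_induct)
       (simp_all add: G0 lin tens cbilinearD[OF bilinear] cbilinearD[OF cbilinear_tens]
         Sum_any_scale finite_tensor_terms Sum_any.distrib ac_simps)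
  have 3: "G a (c *\<^sub>C x) y = c *\<^sub>C G a x y" for a x c
    by (induction y rule: tensor_induct)
       (simp_all add: G0 lin tens cbilinearD[OF bilinear] cbilinearD[OF cbilinear_tens]
         Sum_any_scale finite_tensor_terms scaleC_add_right)
  have 4: "G (c *\<^sub>C x) a y = c *\<^sub>C G x a y" for a x c
    by (induction y rule: tensor_induct)
       (simp_all add: G0 lin tens cbilinearD[OF bilinear] cbilinearD[OF cbilinear_tens]
         Sum_any_scale finite_tensor_terms scaleC_add_right)
  show ?thesis using cbilinearI[of "\<lambda>a b. G a b y", OF 1 3 2 4] by (simp add: G_def)
qed

lemma tensor_prd_tens:
  "tensor_prd prd (a \<otimes> b) n (u \<otimes> v) = Sum_any (\<lambda>i. prd a i u \<otimes> prd b (n - 1 - i) v)"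
  unfolding tensor_prd_def tensor_lift_tens[OF tensor_prd_bilinear_outer]
  by (rule tensor_lift_tens[OF tensor_prd_bilinear_inner])

lemma cbilinear_tensor_prd: "cbilinear (\<lambda>x y. tensor_prd prd x n y)"
proof -
  have lin1: "clinear (\<lambda>x. tensor_prd prd x n y)" for y
    unfolding tensor_prd_def by (rule clinear_tensor_lift[OF tensor_prd_bilinear_outer])
  have add: "tensor_prd prd (x + x') n y = tensor_prd prd x n y + tensor_prd prd x' n y"
    and scale: "tensor_prd prd (c *\<^sub>C x) n y = c *\<^sub>C tensor_prd prd x n y" for x x' y c
    using lin1 unfolding clinear_iff by blast+
  have zero: "tensor_prd prd 0 n y = 0" for y using scale[of 0 0 y] by simp
  have tens: "tensor_prd prd (a \<otimes> b) n (x + y) = tensor_prd prd (a \<otimes> b) n x + tensor_prd prd (a \<otimes> b) n y"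
    "tensor_prd prd (a \<otimes> b) n (c *\<^sub>C x) = c *\<^sub>C tensor_prd prd (a \<otimes> b) n x" for a b x y c
    using clinear_tensor_lift[OF tensor_prd_bilinear_inner[of a b n]]
    unfolding clinear_iff tensor_prd_def
    by (simp_all add: tensor_lift_tens[OF tensor_prd_bilinear_outer])
  have "tensor_prd prd t n (x + y) = tensor_prd prd t n x + tensor_prd prd t n y" for t x y
    by (induction t rule: tensor_induct) (simp_all add: zero add tens algebra_simps)
  moreover have "tensor_prd prd t n (c *\<^sub>C x) = c *\<^sub>C tensor_prd prd t n x" for t x c
    by (induction t rule: tensor_induct) (simp_all add: zero add tens scaleC_add_right)
  ultimately show ?thesis using add scale by (intro cbilinearI) auto
qed

lemma swap_tensor_prd: "swap (tensor_prd prd x n y) = tensor_prd prd (swap x) n (swap y)"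
proof -
  note S = swap_add swap_scale and S0 = swap_zero
  note B = cbilinearD[OF cbilinear_tensor_prd]
  have pure: "swap (tensor_prd prd (a \<otimes> b) n (u \<otimes> v)) = tensor_prd prd (b \<otimes> a) n (v \<otimes> u)"
    for a b u v
  proof -
    let ?f = "\<lambda>i. prd a i u \<otimes> prd b (n - 1 - i) v"
    let ?g = "\<lambda>i. prd b i v \<otimes> prd a (n - 1 - i) u"
    have fin: "finite {i. ?f i \<noteq> 0}" by (rule finite_tensor_terms)
    have sw: "swap (\<Sum>i\<in>I. h i) = (\<Sum>i\<in>I. swap (h i))" for I :: "int set" and h :: "int \<Rightarrow> ('a, 'a) tensor"
      by (induction I rule: infinite_finite_induct) (simp_all add: S0 S)
    have "swap (Sum_any ?f) = (\<Sum>i\<in>{i. ?f i \<noteq> 0}. swap (?f i))"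
      by (simp add: Sum_any.expand_set sw)
    also have "\<dots> = Sum_any (\<lambda>i. swap (?f i))"
      by (rule Sum_any.expand_superset[OF fin, symmetric]) (auto simp: S0)
    also have "\<dots> = Sum_any (\<lambda>i. ?g (n - 1 - i))" by (simp add: swap_tens)
    also have "\<dots> = Sum_any ?g"
      by (rule Sum_any.reindex_cong[of "\<lambda>i. n - 1 - i", symmetric])
         (auto simp: bij_def inj_def surj_def fun_eq_iff intro: exI[of _ "n - 1 - x" for x])
    finally show ?thesis by (simp add: tensor_prd_tens)
  qed
  have "swap (tensor_prd prd (a \<otimes> b) n y) = tensor_prd prd (b \<otimes> a) n (swap y)" for a b
    by (induction y rule: tensor_induct) (simp_all add: B S S0 pure swap_tens)
  then show ?thesis
    by (induction x rule: tensor_induct) (simp_all add: B S S0 swap_tens)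
qed

lemma tensor_prd_fixed:
  assumes "x \<in> fixed_subalgebra" "y \<in> fixed_subalgebra"
  shows "tensor_prd prd x n y \<in> fixed_subalgebra"
  using assms by (simp add: fixed_subalgebra_def swap_tensor_prd)

lemma fixed_C2_subset: "fixed_C2 prd \<subseteq> fixed_subalgebra"
  unfolding C2_def
  by (rule cvec.span_minimal) (auto simp: tensor_prd_fixed subspace_fixed_subalgebra)

end

end

theory Submission
  imports Defs
begin

text \<open>
  A subspace is the intersection of the kernels of the linear functionals that vanish on it. So it
  suffices to show \<open>\<psi> (\<eta> (L\<^bsub>-n\<^esub> \<omega>)) = 0\<close> for every linear functional \<open>\<psi>\<close> on \<open>V \<otimes> V\<close> that kills
  \<open>C\<^sub>2\<close> of the fixed-point algebra, and all computations take place in the complex numbers. Write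
  \<open>K a\<close> for \<open>L\<^bsub>-a\<^esub>\<close> and \<open>\<Phi> u v = \<psi> (u \<otimes> v + v \<otimes> u)\<close>. Three families of products
  \<open>x\<^bsub>(-2)\<^esub> y\<close> constrain the symmetric form \<open>\<Phi>\<close>:

  \<^item> \<open>y = \<one> \<otimes> \<one>\<close> shows that \<open>K 1\<close> is skew for \<open>\<Phi>\<close> (\<open>Phi_K_1\<close>);
  \<^item> \<open>x = \<eta> (K (a - 1) \<one>)\<close> shows that \<open>K a\<close> is skew for \<open>\<Phi>\<close> when \<open>a \<ge> 3\<close> (\<open>Phi_K\<close>);
  \<^item> \<open>x\<close> the symmetrization of \<open>K (a + 2) \<one> \<otimes> K (b + 2) \<one>\<close> gives a relation between values
    \<open>\<Phi> (K i u) (K j v)\<close> with \<open>i + j\<close> fixed (\<open>Phi_product\<close>).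

  By the second family \<open>\<psi> (\<eta> (L\<^bsub>-n\<^esub> \<omega>)) = - X n 2\<close>, where \<open>X a b = \<Phi> (K a \<one>) (K b \<one>)\<close>. Fix the
  weight \<open>N\<close>. By the first family all \<open>X a b\<close> with \<open>a + b = N\<close> are explicit multiples of
  \<open>z = X (N - 2) 2\<close>; when \<open>N\<close> is odd, the symmetry of \<open>X\<close> already forces \<open>z = 0\<close>. The values
  \<open>B a b c = \<Phi> (K a (K b \<one>)) (K c \<one>)\<close> of weight \<open>N\<close> are combinations of \<open>z\<close> and of one further number
  \<open>s\<close> (\<open>B_formula\<close>).

  The values \<open>A a b c d = \<Phi> (K a (K b \<one>)) (K c (K d \<one>))\<close> are symmetric in \<open>a, b, c, d\<close> up to
  values of \<open>B\<close>, unless two of these are \<open>2\<close> (\<open>A_exchange\<close>, \<open>A_flip\<close>). For \<open>N\<close> even, the third family links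
  two such values in which one small index differs by one, up to terms in \<open>z\<close>, \<open>c z\<close> and \<open>s\<close>, with \<open>c\<close> the central
  charge. Along the closed circuit of small indices \<open>(5,3,3), (4,3,3), (4,3,2), (5,3,2)\<close> the \<open>A\<close> cancel.
  What remains is a linear relation between \<open>z\<close>, \<open>c z\<close> and \<open>s\<close>, and on this circuit the coefficients of
  \<open>c z\<close> and \<open>s\<close> vanish as well: it reads
  \<open>(2/945) N (N - 2) (N - 4) \<cdots> (N - 16) z = 0\<close> (\<open>X_even_eq_0\<close>). Hence \<open>z = 0\<close> for every \<open>N \<ge> 18\<close>,
  whatever the central charge, and \<open>\<eta> (L\<^bsub>-n\<^esub> \<omega>)\<close>, where \<open>N = n + 2\<close>, lies in \<open>C\<^sub>2\<close> for \<open>n \<ge> 16\<close>.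
\<close>

section \<open>Functionals vanishing on a subspace\<close>

lemma clinear_functional_separating:
  fixes x :: "'b::complex_vector"
  assumes "x \<notin> cvec.span S"
  shows "\<exists>\<psi> :: 'b \<Rightarrow> complex. clinear \<psi> \<and> (\<forall>y\<in>cvec.span S. \<psi> y = 0) \<and> \<psi> x = 1"
proof -
  interpret pair: vector_space_pair "scaleC :: complex \<Rightarrow> 'b \<Rightarrow> 'b" "scaleC :: complex \<Rightarrow> complex \<Rightarrow> complex"
    by unfold_locales
  obtain B where B: "B \<subseteq> cvec.span S" "cvec.independent B" "cvec.span S \<subseteq> cvec.span B"
    using cvec.maximal_independent_subset[of "cvec.span S"] by blast
  have x: "x \<notin> cvec.span B"
    using assms B(1) cvec.span_minimal[OF B(1)] by auto
  then have "cvec.independent (insert x B)"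
    using B(2) by (simp add: cvec.independent_insert)
  then obtain \<psi> :: "'b \<Rightarrow> complex" where \<psi>: "clinear \<psi>"
      "\<forall>y\<in>insert x B. \<psi> y = (if y = x then 1 else 0)"
    using pair.linear_independent_extend[of "insert x B" "\<lambda>y. if y = x then 1 else 0"] by blast
  have "x \<notin> B" using x cvec.span_base by blast
  then have "\<forall>y\<in>B. \<psi> y = 0" using \<psi>(2) by auto
  then have "\<psi> y = 0" if "y \<in> cvec.span B" for y
    using pair.linear_eq_0_on_span[OF \<psi>(1)] that by blast
  then show ?thesis using \<psi> B(3) by auto
qed

locale C2_functional = vertex_operator_algebra prd vac \<omega> grade central_charge
  for prd :: "'a::complex_vector \<Rightarrow> int \<Rightarrow> 'a \<Rightarrow> 'a"
    and vac \<omega> :: 'a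
    and grade :: "nat \<Rightarrow> 'a set"
    and central_charge :: complex +
  fixes \<psi> :: "('a, 'a) tensor \<Rightarrow> complex"
  assumes linear_\<psi>: "clinear \<psi>"
    and \<psi>_C2: "x \<in> fixed_C2 prd \<Longrightarrow> \<psi> x = 0"

section \<open>Virasoro modes\<close>

context vertex_operator_algebra
begin

text \<open>The sign makes \<open>K a\<close> raise the weight by \<open>a\<close>.\<close>

definition K :: "int \<Rightarrow> 'a \<Rightarrow> 'a" where
  "K n = virasoro prd \<omega> (- n)"

abbreviation Kv :: "int \<Rightarrow> 'a" where
  "Kv n \<equiv> K n vac"

lemma K_linear: "K n (x + y) = K n x + K n y" "K n (t *\<^sub>C x) = t *\<^sub>C K n x" "K n 0 = 0"
  by (simp_all add: K_def virasoro_def cbilinearD[OF bilinear])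

lemma K_prd: "prd \<omega> n x = K (1 - n) x"
  by (simp add: K_def virasoro_def)

lemma Kv_eq_0: "n \<le> 1 \<Longrightarrow> Kv n = 0"
  by (simp add: K_def virasoro_def creation)

lemma Kv_2: "Kv 2 = \<omega>"
  by (simp add: K_def virasoro_def creation)

lemma K_commute:
  "K a (K b x) = K b (K a x) + of_int (b - a) *\<^sub>C K (a + b) x
     + (if a + b = 0 then ((of_int b ^ 3 - of_int b) / 12 * central_charge) *\<^sub>C x else 0)"
proof -
  have "- a + - b = 0 \<longleftrightarrow> a + b = 0" "- a + - b = - (a + b)" "- a - - b = b - a" by auto
  then have "K a (K b x) - K b (K a x) = of_int (b - a) *\<^sub>C K (a + b) x
     + (if a + b = 0 then ((of_int (- a) ^ 3 - of_int (- a)) / 12 * central_charge) *\<^sub>C x else 0)"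
    using virasoro_commutator[of "- a" "- b" x] unfolding K_def by simp
  moreover have "- a = b" if "a + b = 0" using that by simp
  ultimately show ?thesis by (cases "a + b = 0") (simp_all only: if_True if_False diff_eq_eq ac_simps)
qed

lemma K_Kv_small:
  assumes "a \<le> 1"
  shows "K a (Kv b) = of_int (b - a) *\<^sub>C Kv (a + b)
     + (if a + b = 0 then ((of_int b ^ 3 - of_int b) / 12 * central_charge) *\<^sub>C vac else 0)"
  using K_commute[of a b vac] Kv_eq_0[OF assms] by (simp add: K_linear)

lemma Kv_swap: "a + b \<noteq> 0 \<Longrightarrow> K a (Kv b) = K b (Kv a) + of_int (b - a) *\<^sub>C Kv (a + b)"
  using K_commute[of a b vac] by simp

lemma K_1: "K 1 x = prd x (-2) vac"
  using virasoro_minus_1[of x "-1" vac] by (simp add: K_def creation)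

text \<open>\<open>K (k + 2) \<one>\<close> is the divided derivative \<open>L\<^bsub>-1\<^esub>\<^sup>k \<omega> / k!\<close>, so its modes are those of \<open>\<omega>\<close> up to a
  binomial coefficient.\<close>

lemma prd_Kv: "prd (Kv (int k + 2)) n x = ((-1) ^ k * (of_int n gchoose k)) *\<^sub>C K (int k + 1 - n) x"
proof (induction k arbitrary: n)
  case 0
  show ?case by (simp add: Kv_2 K_prd)
next
  case (Suc k)
  have "of_nat (Suc k) *\<^sub>C Kv (int (Suc k) + 2) = K 1 (Kv (int k + 2))"
    using K_Kv_small[of 1 "int k + 2"] by (simp add: add_ac)
  then have "of_nat (Suc k) *\<^sub>C prd (Kv (int (Suc k) + 2)) n x = prd (K 1 (Kv (int k + 2))) n x"
    by (metis cbilinearD(4)[OF bilinear])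
  also have "\<dots> = (- of_int n) *\<^sub>C prd (Kv (int k + 2)) (n - 1) x"
    by (simp add: K_def virasoro_minus_1)
  also have "\<dots> = (of_nat (Suc k) * ((-1) ^ Suc k * (of_int n gchoose Suc k))) *\<^sub>C K (int (Suc k) + 1 - n) x"
  proof -
    have "(of_nat (Suc k) :: complex) * (of_int n gchoose Suc k) = of_int n * (of_int (n - 1) gchoose k)"
      by (metis gbinomial_absorption of_int_1 of_int_diff)
    then have "- (of_int n * ((-1) ^ k * (of_int (n - 1) gchoose k)))
       = (of_nat (Suc k) * ((-1) ^ Suc k * ((of_int n :: complex) gchoose Suc k)))"
      by (simp only: power_Suc mult_minus_left mult_minus_right mult_1) (metis mult.left_commute)
    moreover have "int k + 1 - (n - 1) = int (Suc k) + 1 - n" by simp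
    ultimately show ?thesis unfolding Suc.IH scaleC_scaleC by (simp only: mult_minus_left)
  qed
  finally have "inverse (of_nat (Suc k)) *\<^sub>C (of_nat (Suc k) *\<^sub>C prd (Kv (int (Suc k) + 2)) n x)
     = inverse (of_nat (Suc k)) *\<^sub>C ((of_nat (Suc k) * ((-1) ^ Suc k * (of_int n gchoose Suc k))) *\<^sub>C K (int (Suc k) + 1 - n) x)"
    by (rule arg_cong)
  then show ?case
    unfolding scaleC_scaleC mult.assoc[symmetric] by (simp add: scaleC_one del: of_nat_Suc)
qed

end

section \<open>The symmetric form of a functional and its invariance\<close>

context C2_functional
begin

lemma \<psi>_linear: "\<psi> (x + y) = \<psi> x + \<psi> y" "\<psi> (t *\<^sub>C x) = t * \<psi> x" "\<psi> 0 = 0"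
proof -
  show "\<psi> (x + y) = \<psi> x + \<psi> y" and s: "\<psi> (t *\<^sub>C x) = t * \<psi> x" for x y t
    using linear_\<psi> unfolding clinear_iff by (auto simp: scaleC_complex_def)
  show "\<psi> 0 = 0" using s[of 0 0] by simp
qed

definition Phi :: "'a \<Rightarrow> 'a \<Rightarrow> complex" where
  "Phi u v = \<psi> (u \<otimes> v + v \<otimes> u)"

lemma Phi_linear:
  "Phi (u + u') v = Phi u v + Phi u' v" "Phi u (v + v') = Phi u v + Phi u v'"
  "Phi (t *\<^sub>C u) v = t * Phi u v" "Phi u (t *\<^sub>C v) = t * Phi u v" "Phi 0 v = 0" "Phi u 0 = 0"
  by (simp_all add: Phi_def cbilinearD[OF cbilinear_tens] \<psi>_linear algebra_simps)

lemma Phi_commute: "Phi u v = Phi v u"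
  by (simp add: Phi_def add.commute)

lemma \<psi>_product:
  assumes "x \<in> fixed_subalgebra" "y \<in> fixed_subalgebra"
  shows "\<psi> (tensor_prd prd x (-2) y) = 0"
  by (rule \<psi>_C2) (use assms in \<open>auto simp: C2_def intro: cvec.span_base\<close>)

lemma sym_fixed: "u \<otimes> v + v \<otimes> u \<in> fixed_subalgebra"
  by (simp add: fixed_subalgebra_def swap_add swap_tens add.commute)

lemma vac_fixed: "vac \<otimes> vac \<in> fixed_subalgebra"
  by (simp add: fixed_subalgebra_def swap_tens)

text \<open>For \<open>x\<close> in the fixed-point algebra, \<open>x\<^bsub>(-2)\<^esub> (\<one> \<otimes> \<one>)\<close> is the translate of \<open>x\<close>, and translation on
  the tensor square is \<open>K 1 \<otimes> id + id \<otimes> K 1\<close>.\<close>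

lemma Phi_K_1: "Phi (K 1 u) v = - Phi u (K 1 v)"
proof -
  have *: "tensor_prd prd (a \<otimes> b) (-2) (vac \<otimes> vac) = K 1 a \<otimes> b + a \<otimes> K 1 b" for a b
  proof -
    have "tensor_prd prd (a \<otimes> b) (-2) (vac \<otimes> vac) =
      (\<Sum>i\<in>{-2, -1}. prd a i vac \<otimes> prd b (- 2 - 1 - i) vac)"
      unfolding tensor_prd_tens
    proof (rule Sum_any.expand_superset)
      show "{i. prd a i vac \<otimes> prd b (- 2 - 1 - i) vac \<noteq> 0} \<subseteq> {-2, -1}"
      proof
        fix i assume i: "i \<in> {i. prd a i vac \<otimes> prd b (- 2 - 1 - i) vac \<noteq> 0}"
        then have "prd a i vac \<noteq> 0" "prd b (- 2 - 1 - i) vac \<noteq> 0"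
          by (auto simp: cbilinearD[OF cbilinear_tens])
        then have "\<not> i \<ge> 0" "\<not> - 2 - 1 - i \<ge> 0" using creation(2) by blast+
        then show "i \<in> {-2, -1}" by auto
      qed
    qed simp
    then show ?thesis by (simp add: K_1 creation)
  qed
  have "\<psi> (tensor_prd prd (u \<otimes> v + v \<otimes> u) (-2) (vac \<otimes> vac)) = 0"
    by (rule \<psi>_product) (auto simp: sym_fixed vac_fixed)
  then have "Phi (K 1 u) v + Phi u (K 1 v) = 0"
    by (simp add: cbilinearD[OF cbilinear_tensor_prd] * Phi_def \<psi>_linear algebra_simps)
  then show ?thesis by (simp add: eq_neg_iff_add_eq_0)
qed

text \<open>The mode \<open>-2\<close> of \<open>\<eta> (K (a - 1) \<one>)\<close> is \<open>a - 2\<close> times \<open>K a \<otimes> id + id \<otimes> K a\<close>; the factor is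
  nonzero for \<open>a \<ge> 3\<close>.\<close>

lemma Phi_K:
  assumes "a \<ge> 3"
  shows "Phi (K a u) v = - Phi u (K a v)"
proof -
  define k where "k = nat (a - 3)"
  have a: "a = int k + 3" using assms by (simp add: k_def)
  \<comment> \<open>\<open>?x\<close> is \<open>K (a - 1) \<one>\<close>, with \<open>a = k + 3\<close>.\<close>
  let ?x = "Kv (int k + 2)"
  have left: "tensor_prd prd (x \<otimes> vac) (-2) (u \<otimes> v) = prd x (-2) u \<otimes> v"
    and right: "tensor_prd prd (vac \<otimes> x) (-2) (u \<otimes> v) = u \<otimes> prd x (-2) v" for x u v
  proof -
    have "tensor_prd prd (x \<otimes> vac) (-2) (u \<otimes> v) =
        (\<Sum>i\<in>{-2}. prd x i u \<otimes> prd vac (- 2 - 1 - i) v)"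
      unfolding tensor_prd_tens
      by (rule Sum_any.expand_superset) (auto simp: vacuum cbilinearD[OF cbilinear_tens] split: if_splits)
    then show "tensor_prd prd (x \<otimes> vac) (-2) (u \<otimes> v) = prd x (-2) u \<otimes> v" by (simp add: vacuum)
    have "tensor_prd prd (vac \<otimes> x) (-2) (u \<otimes> v) =
        (\<Sum>i\<in>{-1}. prd vac i u \<otimes> prd x (- 2 - 1 - i) v)"
      unfolding tensor_prd_tens
      by (rule Sum_any.expand_superset) (auto simp: vacuum cbilinearD[OF cbilinear_tens] split: if_splits)
    then show "tensor_prd prd (vac \<otimes> x) (-2) (u \<otimes> v) = u \<otimes> prd x (-2) v" by (simp add: vacuum)
  qed
  have "\<psi> (tensor_prd prd (?x \<otimes> vac + vac \<otimes> ?x) (-2) (u \<otimes> v + v \<otimes> u)) = 0"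
    by (intro \<psi>_product sym_fixed)
  then have "Phi (prd ?x (-2) u) v + Phi u (prd ?x (-2) v) = 0"
    by (simp add: cbilinearD[OF cbilinear_tensor_prd] left right Phi_def \<psi>_linear algebra_simps)
  moreover have "prd ?x (-2) w = of_nat (Suc k) *\<^sub>C K a w" for w
  proof -
    have "((-1) ^ k * ((- 2 :: complex) gchoose k)) = of_nat (Suc k)"
    proof -
      have "((- 2 :: complex) gchoose k) = (-1) ^ k * (of_nat (Suc k) gchoose k)"
        using gbinomial_minus[of "2 :: complex" k] by (simp add: add_ac)
      also have "(of_nat (Suc k) gchoose k :: complex) = of_nat (Suc k)"
        by (metis binomial_gbinomial binomial_Suc_n)
      finally show ?thesis by (simp add: power_mult_distrib[symmetric] flip: mult.assoc)
    qed
    then show ?thesis using prd_Kv[of k "-2" w] by (simp add: a add_ac)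
  qed
  ultimately have "of_nat (Suc k) * (Phi (K a u) v + Phi u (K a v)) = 0"
    by (simp only: Phi_linear distrib_left)
  then have "Phi (K a u) v + Phi u (K a v) = 0"
    by (metis mult_eq_0_iff of_nat_neq_0)
  then show ?thesis by (simp add: eq_neg_iff_add_eq_0)
qed

section \<open>Products with symmetrized pairs of Virasoro descendants\<close>

lemma \<psi>_sum: "\<psi> (sum f I) = (\<Sum>i\<in>I. \<psi> (f i))"
  by (induction I rule: infinite_finite_induct) (simp_all add: \<psi>_linear)

lemma gbinomial_reflect: "(-1) ^ k * (of_int (int k - 1 - l) gchoose k) = (of_int l gchoose k :: complex)"
  using gbinomial_negated_upper[of "of_int l :: complex" k] by (simp add: algebra_simps)

text \<open>The summation index \<open>l\<close> is chosen such that \<open>K (l + 2)\<close> acts with weight \<open>l choose a\<close>; the range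
  \<open>- R \<le> l \<le> M + R\<close> contains all indices at which neither factor is annihilated.\<close>

lemma Phi_product_sum:
  fixes a b R :: nat and u v :: 'a
  defines "M \<equiv> int a + int b + 1"
  assumes u: "\<And>j. j < 2 - int R \<Longrightarrow> K j u = 0" and v: "\<And>j. j < 2 - int R \<Longrightarrow> K j v = 0"
  shows "(\<Sum>l\<in>{- int R..M + int R}. (of_int l gchoose a) * (of_int (M - l) gchoose b)
      * (Phi (K (l + 2) u) (K (M - l + 2) v) + Phi (K (l + 2) v) (K (M - l + 2) u))) = 0"
proof -
  let ?I = "{- int R..M + int R}"
  let ?c = "\<lambda>l. (of_int l gchoose a) * (of_int (M - l) gchoose b) :: complex"
  have *: "tensor_prd prd (Kv (int a + 2) \<otimes> Kv (int b + 2)) (-2) (u \<otimes> v)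
      = (\<Sum>l\<in>?I. ?c l *\<^sub>C (K (l + 2) u \<otimes> K (M - l + 2) v))"
    if u: "\<And>j. j < 2 - int R \<Longrightarrow> K j u = 0" and v: "\<And>j. j < 2 - int R \<Longrightarrow> K j v = 0" for u v
  proof -
    let ?f = "\<lambda>i. prd (Kv (int a + 2)) i u \<otimes> prd (Kv (int b + 2)) (- 2 - 1 - i) v"
    let ?h = "\<lambda>l. int a - 1 - l"
    have f: "?f (?h l) = ?c l *\<^sub>C (K (l + 2) u \<otimes> K (M - l + 2) v)" for l
    proof -
      have i: "int a + 1 - ?h l = l + 2" "- 2 - 1 - ?h l = int b - 1 - (M - l)"
        "int b + 1 - (int b - 1 - (M - l)) = M - l + 2"
        by (simp_all add: M_def)
      show ?thesis
        unfolding prd_Kv i gbinomial_reflect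
        by (simp add: cbilinearD[OF cbilinear_tens] scaleC_scaleC mult.commute)
    qed
    have "Sum_any ?f = (\<Sum>i\<in>?h ` ?I. ?f i)"
    proof (rule Sum_any.expand_superset)
      show "{i. ?f i \<noteq> 0} \<subseteq> ?h ` ?I"
      proof
        fix i assume "i \<in> {i. ?f i \<noteq> 0}"
        then have "?f (?h (?h i)) \<noteq> 0" by simp
        then have "K (?h i + 2) u \<noteq> 0" "K (M - ?h i + 2) v \<noteq> 0"
          unfolding f by (auto simp: cbilinearD[OF cbilinear_tens])
        then have "\<not> ?h i + 2 < 2 - int R" "\<not> M - ?h i + 2 < 2 - int R" using u v by blast+
        then have "?h i \<in> ?I" by auto
        then have "?h (?h i) \<in> ?h ` ?I" by (rule imageI)
        then show "i \<in> ?h ` ?I" by simp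
      qed
    qed simp
    also have "\<dots> = (\<Sum>l\<in>?I. ?f (?h l))"
      by (subst sum.reindex) (auto simp: inj_on_def)
    finally show ?thesis unfolding tensor_prd_tens f .
  qed
  have swap: "tensor_prd prd (Kv (int b + 2) \<otimes> Kv (int a + 2)) (-2) (v \<otimes> u)
      = (\<Sum>l\<in>?I. ?c l *\<^sub>C (K (M - l + 2) v \<otimes> K (l + 2) u))"
    if u: "\<And>j. j < 2 - int R \<Longrightarrow> K j u = 0" and v: "\<And>j. j < 2 - int R \<Longrightarrow> K j v = 0" for u v
  proof -
    have "swap (sum f I) = (\<Sum>l\<in>I. swap (f l))" for f :: "int \<Rightarrow> ('a, 'a) tensor" and I
      by (induction I rule: infinite_finite_induct) (simp_all add: swap_zero swap_add)
    then show ?thesis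
      using arg_cong[OF *[OF u v], of swap]
      by (simp add: swap_tensor_prd swap_tens swap_scale)
  qed
  let ?X = "Kv (int a + 2) \<otimes> Kv (int b + 2) + Kv (int b + 2) \<otimes> Kv (int a + 2)"
  have "\<psi> (tensor_prd prd ?X (-2) (u \<otimes> v + v \<otimes> u)) = 0"
    by (intro \<psi>_product sym_fixed)
  then show ?thesis
    by (simp add: cbilinearD[OF cbilinear_tensor_prd] * swap u v \<psi>_linear \<psi>_sum Phi_def
        sum.distrib distrib_left ac_simps)
qed

lemma gbinomial_int_eq_0: "0 \<le> l \<Longrightarrow> l < int k \<Longrightarrow> (of_int l gchoose k :: complex) = 0"
proof -
  assume l: "0 \<le> l" "l < int k"
  then have "of_int l = (of_nat (nat l) :: complex)" by simp
  moreover have "nat l < k" using l by auto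
  ultimately show ?thesis by (simp flip: binomial_gbinomial add: binomial_eq_0)
qed

text \<open>The coefficients of the summands \<open>l = - k\<close> and \<open>l = M + k\<close> of \<open>Phi_product_sum\<close>, added up: these two
  summands agree because \<open>\<Phi>\<close> is symmetric.\<close>

definition outer_weight :: "nat \<Rightarrow> nat \<Rightarrow> nat \<Rightarrow> complex" where
  "outer_weight a b k = (- of_nat k gchoose a) * (of_nat (a + b + 1 + k) gchoose b)
     + (of_nat (a + b + 1 + k) gchoose a) * (- of_nat k gchoose b)"

text \<open>Since \<open>a + b = M - 1\<close>, the weight \<open>(l choose a) (M - l choose b)\<close> vanishes for all \<open>0 \<le> l \<le> M\<close>
  but \<open>l = a\<close> and \<open>l = a + 1\<close>. So the relation couples two neighbouring values in which both operators raise
  the weight; in the remaining summands one operator \<open>K (2 - k)\<close> with \<open>k \<ge> 1\<close> can be commuted to the vacuum.\<close>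

lemma Phi_product:
  fixes a b R :: nat and u v :: 'a
  defines "M \<equiv> int a + int b + 1"
  assumes u: "\<And>j. j < 2 - int R \<Longrightarrow> K j u = 0" and v: "\<And>j. j < 2 - int R \<Longrightarrow> K j v = 0"
  shows "of_nat (b + 1) * (Phi (K (int a + 2) u) (K (int b + 3) v) + Phi (K (int a + 2) v) (K (int b + 3) u))
     + of_nat (a + 1) * (Phi (K (int a + 3) u) (K (int b + 2) v) + Phi (K (int a + 3) v) (K (int b + 2) u))
     + (\<Sum>k\<in>{1..R}. outer_weight a b k *
         (Phi (K (2 - int k) u) (K (M + int k + 2) v) + Phi (K (2 - int k) v) (K (M + int k + 2) u))) = 0"
proof -
  let ?g = "\<lambda>l. Phi (K (l + 2) u) (K (M - l + 2) v) + Phi (K (l + 2) v) (K (M - l + 2) u)"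
  let ?f = "\<lambda>l. (of_int l gchoose a) * (of_int (M - l) gchoose b) * ?g l"
  have "0 = (\<Sum>l\<in>{- int R..M + int R}. ?f l)"
    unfolding M_def by (rule Phi_product_sum[symmetric]) (use u v in auto)
  also have "{- int R..M + int R} = {- int R..-1} \<union> ({0..M} \<union> {M + 1..M + int R})"
    by (auto simp: M_def)
  also have "sum ?f \<dots> = sum ?f {- int R..-1} + (sum ?f {0..M} + sum ?f {M + 1..M + int R})"
    by (subst sum.union_disjoint; (subst sum.union_disjoint)?) (auto simp: M_def)
  also have "sum ?f {0..M} = sum ?f {int a, int a + 1}"
  proof (rule sum.mono_neutral_right)
    show "\<forall>l\<in>{0..M} - {int a, int a + 1}. ?f l = 0"
    proof
      fix l assume l: "l \<in> {0..M} - {int a, int a + 1}"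
      then have "l < int a \<or> M - l < int b" by (auto simp: M_def)
      then have "(of_int l gchoose a :: complex) = 0 \<or> (of_int (M - l) gchoose b :: complex) = 0"
        using gbinomial_int_eq_0[of l a] gbinomial_int_eq_0[of "M - l" b] l by auto
      then show "?f l = 0" by auto
    qed
  qed (auto simp: M_def)
  also have "\<dots> = of_nat (b + 1) * ?g (int a) + of_nat (a + 1) * ?g (int a + 1)"
  proof -
    have 1: "(of_int (int n) gchoose n :: complex) = 1" for n
      by (simp flip: binomial_gbinomial)
    have 2: "(of_int (int n + 1) gchoose n :: complex) = of_nat (n + 1)" for n
      by (metis binomial_Suc_n binomial_gbinomial of_int_of_nat_eq of_nat_Suc of_int_add of_int_1 Suc_eq_plus1 add.commute)
    have M: "M - int a = int b + 1" "M - (int a + 1) = int b" by (simp_all add: M_def)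
    have "sum ?f {int a, int a + 1} = ?f (int a) + ?f (int a + 1)" by simp
    also have "\<dots> = of_nat (b + 1) * ?g (int a) + of_nat (a + 1) * ?g (int a + 1)"
      unfolding M 1 2 by simp
    finally show ?thesis .
  qed
  also have "sum ?f {- int R..-1} = (\<Sum>k\<in>{1..R}. ?f (- int k))"
    by (rule sum.reindex_bij_witness[of _ "\<lambda>k. - int k" "\<lambda>l. nat (- l)"]) auto
  also have "sum ?f {M + 1..M + int R} = (\<Sum>k\<in>{1..R}. ?f (M + int k))"
    by (rule sum.reindex_bij_witness[of _ "\<lambda>k. M + int k" "\<lambda>l. nat (l - M)"]) auto
  finally have "of_nat (b + 1) * ?g (int a) + of_nat (a + 1) * ?g (int a + 1)
      + (\<Sum>k\<in>{1..R}. ?f (- int k) + ?f (M + int k)) = 0"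
    by (simp add: sum.distrib algebra_simps)
  moreover have "?f (- int k) + ?f (M + int k) = outer_weight a b k *
     (Phi (K (2 - int k) u) (K (M + int k + 2) v) + Phi (K (2 - int k) v) (K (M + int k + 2) u))" for k
  proof -
    have "of_int (M + int k) = (of_nat (a + b + 1 + k) :: complex)" by (simp add: M_def)
    moreover have "?g (M + int k) = ?g (- int k)"
      by (simp add: Phi_commute[of _ "K (2 - int k) _"] add_ac)
    ultimately show ?thesis
      by (simp add: outer_weight_def distrib_right add_ac del: of_nat_add)
  qed
  moreover have "M - int a + 2 = int b + 3" "M - (int a + 1) + 2 = int b + 2" "int a + 1 + 2 = int a + 3"
    by (simp_all add: M_def)
  ultimately show ?thesis by simp
qed

section \<open>Values of the form with two and three modes\<close>

definition X :: "int \<Rightarrow> int \<Rightarrow> complex" where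
  "X a b = Phi (Kv a) (Kv b)"

text \<open>\<open>Y\<close> is \<open>X\<close> after multiplication by \<open>\<eta> \<omega>\<close>. It measures the failure of \<open>K 2\<close> to be skew, which
  \<open>Phi_K\<close> does not cover.\<close>

definition Y :: "int \<Rightarrow> int \<Rightarrow> complex" where
  "Y a b = Phi (K 2 (Kv a)) (Kv b) + Phi (Kv a) (K 2 (Kv b))"

definition B :: "int \<Rightarrow> int \<Rightarrow> int \<Rightarrow> complex" where
  "B a b c = Phi (K a (Kv b)) (Kv c)"

definition A :: "int \<Rightarrow> int \<Rightarrow> int \<Rightarrow> int \<Rightarrow> complex" where
  "A a b c d = Phi (K a (Kv b)) (K c (Kv d))"

lemma X_commute: "X a b = X b a"
  by (simp add: X_def Phi_commute)

lemma K_1_Kv: "K 1 (Kv a) = of_int (a - 1) *\<^sub>C Kv (a + 1)"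
  using K_Kv_small[of 1 a] by (cases "a = - 1") (simp_all add: add.commute[of 1] add_eq_0_iff)

lemma X_shift: "of_int (a - 1) * X (a + 1) b = - of_int (b - 1) * X a (b + 1)"
  using Phi_K_1[of "Kv a" "Kv b"] by (simp add: X_def K_1_Kv Phi_linear del: of_int_diff)

text \<open>\<open>Y\<close> obeys the same rule because \<open>K 2\<close> and \<open>K 1\<close> commute up to \<open>K 3\<close>, which is skew.\<close>

lemma Y_shift: "of_int (a - 1) * Y (a + 1) b = - of_int (b - 1) * Y a (b + 1)"
proof -
  have K2: "K 2 (K 1 u) = K 1 (K 2 u) - K 3 u" for u
    using K_commute[of 2 1 u] by (simp add: scaleC_one)
  have "Phi (K 2 (K 1 (Kv a))) (Kv b) + Phi (K 1 (Kv a)) (K 2 (Kv b))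
      = - (Phi (K 2 (Kv a)) (K 1 (Kv b)) + Phi (Kv a) (K 2 (K 1 (Kv b))))"
    unfolding K2 using Phi_linear(2)[of _ "K 1 (K 2 (Kv b)) - K 3 (Kv b)" "K 3 (Kv b)"]
      Phi_linear(1)[of "K 1 (K 2 (Kv a)) - K 3 (Kv a)" "K 3 (Kv a)"]
    by (simp add: Phi_K_1 Phi_K algebra_simps)
  then show ?thesis
    by (simp add: K_1_Kv K_linear Phi_linear Y_def algebra_simps del: of_int_diff)
qed

text \<open>\<open>chi (N - 4)\<close> is the solution, normalized at \<open>b = 2\<close>, of the recursion that \<open>X_shift\<close> imposes in weight
  \<open>N\<close>.\<close>

definition chi :: "complex \<Rightarrow> int \<Rightarrow> complex" where
  "chi t b = (-1) ^ nat (b - 2) * (t gchoose nat (b - 2))"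

lemma chi_closed_form:
  fixes F :: "int \<Rightarrow> int \<Rightarrow> complex"
  assumes shift: "\<And>a b. of_int (a - 1) * F (a + 1) b = - of_int (b - 1) * F a (b + 1)"
    and "b \<ge> 2" "a + b = N"
  shows "F a b = chi (of_int N - 4) b * F (N - 2) 2"
proof -
  have "F (N - 2 - int k) (2 + int k) = (-1) ^ k * ((of_int N - 4) gchoose k) * F (N - 2) 2" for k
  proof (induction k)
    case 0
    show ?case by simp
  next
    case (Suc k)
    let ?t = "of_int N - 4 :: complex"
    have "of_nat (Suc k) * F (N - 2 - int (Suc k)) (2 + int (Suc k))
        = - ((?t - of_nat k) * F (N - 2 - int k) (2 + int k))"
      using shift[of "N - 3 - int k" "2 + int k"] by (simp add: algebra_simps)
    also have "\<dots> = (-1) ^ Suc k * ((?t - of_nat k) * (?t gchoose k)) * F (N - 2) 2"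
      by (simp add: Suc.IH)
    also have "(?t - of_nat k) * (?t gchoose k) = of_nat (Suc k) * (?t gchoose Suc k)"
      using gbinomial_mult_1[of ?t k] by (simp add: algebra_simps)
    also have "(-1) ^ Suc k * (of_nat (Suc k) * (?t gchoose Suc k)) * F (N - 2) 2
       = of_nat (Suc k) * ((-1) ^ Suc k * (?t gchoose Suc k) * F (N - 2) 2)"
      by (simp only: mult_ac)
    finally show ?case
      by (metis mult_cancel_left of_nat_neq_0)
  qed
  moreover have "N - 2 - int (nat (b - 2)) = a" "2 + int (nat (b - 2)) = b"
    using assms(2,3) by auto
  ultimately show ?thesis
    unfolding chi_def by metis
qed

lemma B_swap: "a \<ge> 3 \<Longrightarrow> B a b c = - B a c b"
  using Phi_K[of a "Kv b" "Kv c"] by (simp add: B_def Phi_commute[of "Kv b"])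

lemma B_commute: "a + b \<noteq> 0 \<Longrightarrow> B a b c = B b a c + of_int (b - a) * X (a + b) c"
  by (simp add: B_def X_def Kv_swap[of a b] Phi_linear)

text \<open>Alternately moving the outer mode to the other argument (\<open>B_swap\<close>, with a sign) and commuting the two
  modes of the first argument (\<open>B_commute\<close>, with a value of \<open>X\<close>) permutes \<open>a, b, c\<close>. Three moves of each kind
  lead back to \<open>B a b c\<close> with the opposite sign, which determines it. If one index is \<open>2\<close>, the circuit is
  interrupted, because \<open>K 2\<close> cannot be moved across, and \<open>Y\<close> closes it.\<close>

lemma B_formula:
  assumes "a \<ge> 3" "b \<ge> 2" "c \<ge> 2"
  shows "2 * B a b c = of_int (b - a) * X (a + b) c + of_int (b - c) * X a (b + c)
     + of_int (a - c) * X (a + c) b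
     + (if b = 2 then Y a c else 0) - (if c = 2 then Y a b else 0)"
proof -
  have two: "2 * B a 2 c = of_int (2 - a) * X (a + 2) c + of_int (2 - c) * X a (2 + c)
     + of_int (a - c) * X (a + c) 2 + Y a c" if "a \<ge> 3" "c \<ge> 3" for a c
  proof -
    have "Y a c = B 2 a c + B 2 c a"
      by (simp add: Y_def B_def Phi_commute)
    moreover have "B a 2 c = - (B c a 2 + of_int (c - a) * X (a + c) 2)"
      using B_swap[of a 2 c] B_commute[of a c 2] that by simp
    moreover have "B 2 a c = B a 2 c + of_int (a - 2) * X (a + 2) c"
      using B_commute[of 2 a c] that by (simp add: add.commute)
    moreover have "B 2 c a = B c 2 a + of_int (c - 2) * X a (2 + c)"
      using B_commute[of 2 c a] that by (simp add: X_commute[of "2 + c"])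
    moreover have "B c a 2 = - B c 2 a"
      using B_swap[of c a 2] that by simp
    ultimately show ?thesis
      unfolding of_int_diff by algebra
  qed
  consider "b \<ge> 3" "c \<ge> 3" | "b = 2" "c \<ge> 3" | "b \<ge> 3" "c = 2" | "b = 2" "c = 2"
    using assms by linarith
  then show ?thesis
  proof cases
    case 1
    have "B a b c = - B a c b" "B c a b = - B c b a" "B b c a = - B b a c"
      by (rule B_swap; use assms 1 in simp)+
    moreover have "B a c b = B c a b + of_int (c - a) * X (a + c) b"
      "B c b a = B b c a + of_int (b - c) * X a (b + c)"
      "B a b c = B b a c + of_int (b - a) * X (a + b) c"
      using B_commute[of a c b] B_commute[of c b a] B_commute[of a b c] assms
      by (simp_all add: X_commute[of "b + c" a] add.commute)
    ultimately have "2 * B a b c = of_int (b - a) * X (a + b) c + of_int (b - c) * X a (b + c)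
     + of_int (a - c) * X (a + c) b"
      unfolding of_int_diff by algebra
    then show ?thesis using 1 by simp
  next
    case 2
    then show ?thesis using two[of a c] assms by simp
  next
    case 3
    have "2 * B a 2 b = of_int (2 - a) * X (a + 2) b + of_int (2 - b) * X a (b + 2)
     + of_int (a - b) * X (a + b) 2 + Y a b"
      using two[of a b] 3 assms by (simp only: add.commute)
    moreover have "B a b 2 = - B a 2 b"
      by (rule B_swap) (use assms in simp)
    ultimately have "2 * B a b 2 = of_int (b - a) * X (a + b) 2 + of_int (b - 2) * X a (b + 2)
     + of_int (a - 2) * X (a + 2) b - Y a b"
      unfolding of_int_diff by algebra
    then show ?thesis using 3 by simp
  next
    case 4
    then show ?thesis using B_swap[of a 2 2] assms by (simp add: algebra_simps)
  qed
qed

section \<open>Values of the form with four modes\<close>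

lemma A_flip: "c + d \<noteq> 0 \<Longrightarrow> A a b c d = A a b d c + of_int (d - c) * B a b (c + d)"
  by (simp add: A_def B_def Kv_swap[of c d] Phi_linear)

text \<open>Moving \<open>K c\<close> to the first argument, past \<open>K a\<close>, and then \<open>K a\<close> to the second exchanges the inner
  modes; the two signs cancel.\<close>

lemma A_exchange:
  assumes "a \<ge> 3" "c \<ge> 3"
  shows "A a b c d = A a d c b + of_int (a - c) * B (a + c) d b"
proof -
  have "A a b c d = - Phi (K c (K a (Kv b))) (Kv d)"
    using assms by (simp add: A_def Phi_K[of c] Phi_commute[of "K a (Kv b)"])
  also have "K c (K a (Kv b)) = K a (K c (Kv b)) + of_int (a - c) *\<^sub>C K (a + c) (Kv b)"
    using K_commute[of c a "Kv b"] assms by (simp add: add.commute)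
  also have "- Phi \<dots> (Kv d) = A a d c b - of_int (a - c) * B (a + c) b d"
    using assms by (simp add: Phi_linear Phi_K[of a] A_def B_def Phi_commute[of "K c (Kv b)"])
  also have "\<dots> = A a d c b + of_int (a - c) * B (a + c) d b"
    using B_swap[of "a + c" b d] assms by simp
  finally show ?thesis .
qed

text \<open>Rewriting rules that bring the three small indices into decreasing order.\<close>

lemma A_sort:
  assumes "e \<ge> 3" "y \<ge> 3"
  shows "A e y 2 3 = A e y 3 2 + B e y 5"
    and "A e 2 y 3 = A e y 2 3 + of_int (3 - y) * B e 2 (y + 3) + of_int (e - 3) * B (e + 3) y 2 - B e y 5"
    and "A e 3 y 2 = A e 2 y 3 + of_int (e - y) * B (e + y) 2 3"
    and "A e 3 2 y = A e 3 y 2 + of_int (y - 2) * B e 3 (y + 2)"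
    and "A e 3 3 y = A e y 3 3 + of_int (e - 3) * B (e + 3) y 3"
    and "A e 3 y 3 = A e 3 3 y + of_int (3 - y) * B e 3 (y + 3)"
  using assms A_flip[of 2 3 e y] A_flip[of y 3 e 2] A_exchange[of e 3 2 y] A_exchange[of e y 3 2]
    A_flip[of 2 y e 3] A_exchange[of e 3 3 y] A_flip[of y 3 e 3]
  by (simp_all add: add.commute)

text \<open>The term with the central charge comes from \<open>k = p + 2\<close>, where \<open>K (2 - k)\<close> maps \<open>K p \<one>\<close> to a
  multiple of the vacuum.\<close>

lemma inner_term:
  assumes "k \<ge> 1" "e \<ge> 3" "p \<ge> 2"
  shows "Phi (K (2 - k) (Kv p)) (K e (Kv q)) =
    (if k \<le> p then of_int (p + k - 2) * B e q (p + 2 - k)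
     else if k = p + 2 then - ((of_int p ^ 3 - of_int p) / 12 * central_charge) * X e q else 0)"
proof -
  have "Phi (K (2 - k) (Kv p)) (K e (Kv q)) = of_int (p + k - 2) * Phi (Kv (p + 2 - k)) (K e (Kv q))
     + (if k = p + 2 then ((of_int p ^ 3 - of_int p) / 12 * central_charge) * Phi vac (K e (Kv q)) else 0)"
  proof -
    have "2 - k + p = p + 2 - k" "p - (2 - k) = p + k - 2" "p + 2 - k = 0 \<longleftrightarrow> k = p + 2" by auto
    then have "K (2 - k) (Kv p) = of_int (p + k - 2) *\<^sub>C Kv (p + 2 - k)
        + (if k = p + 2 then ((of_int p ^ 3 - of_int p) / 12 * central_charge) *\<^sub>C vac else 0)"
      using K_Kv_small[of "2 - k" p] assms(1) by (simp only: if_cancel)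
    then show ?thesis by (simp add: Phi_linear)
  qed
  moreover have "Phi vac (K e (Kv q)) = - X e q"
    using Phi_K[of e vac "Kv q"] assms by (simp add: X_def)
  moreover have "Phi (Kv (p + 2 - k)) (K e (Kv q)) = (if k \<le> p then B e q (p + 2 - k) else 0)"
    by (auto simp: Phi_commute B_def Kv_eq_0 Phi_linear)
  ultimately show ?thesis by auto
qed

lemma K_Kv_eq_0: "j < - p \<Longrightarrow> p \<ge> 0 \<Longrightarrow> K j (Kv p) = 0"
  using K_Kv_small[of j p] by (simp add: Kv_eq_0 K_linear)

lemma A_product:
  fixes a b R :: nat and p q :: int
  assumes "2 \<le> p" "p + 2 \<le> int R" "2 \<le> q" "q + 2 \<le> int R"
  defines "T \<equiv> \<lambda>p q k. if k \<le> p then of_int (p + k - 2) * B (int a + int b + 3 + k) q (p + 2 - k)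
     else if k = p + 2 then - ((of_int p ^ 3 - of_int p) / 12 * central_charge) * X (int a + int b + 3 + k) q else 0"
  shows "of_nat (b + 1) * (A (int b + 3) q (int a + 2) p + A (int b + 3) p (int a + 2) q)
     + of_nat (a + 1) * (A (int b + 2) q (int a + 3) p + A (int b + 2) p (int a + 3) q)
     + (\<Sum>k\<in>{1..R}. outer_weight a b k * (T p q (int k) + T q p (int k))) = 0"
proof -
  have "Phi (K (2 - int k) (Kv p)) (K (int a + int b + 1 + int k + 2) (Kv q)) = T p q (int k)"
    if "k \<in> {1..R}" "2 \<le> p" for k p q
    using inner_term[of "int k" "int a + int b + 3 + int k" p q] that
    by (simp add: T_def add_ac)
  then have "(\<Sum>k\<in>{1..R}. outer_weight a b k *
         (Phi (K (2 - int k) (Kv p)) (K (int a + int b + 1 + int k + 2) (Kv q))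
          + Phi (K (2 - int k) (Kv q)) (K (int a + int b + 1 + int k + 2) (Kv p))))
      = (\<Sum>k\<in>{1..R}. outer_weight a b k * (T p q (int k) + T q p (int k)))"
    using assms(1,3) by (intro sum.cong refl) simp
  moreover have "K j (Kv p) = 0" "K j (Kv q) = 0" if "j < 2 - int R" for j
    using that assms by (auto intro!: K_Kv_eq_0)
  note Phi_product[where a = a and b = b and R = R, OF this]
  ultimately show ?thesis
    by (simp add: A_def Phi_commute[of "K (int a + _) _"])
qed

section \<open>Evaluation of the coefficients as polynomials in the weight\<close>

lemma gbinomial_numeral:
  "(x :: complex) gchoose numeral k = (x gchoose pred_numeral k) * (x - of_nat (pred_numeral k)) / numeral k"
proof -
  have "(x gchoose Suc j) = (x gchoose j) * (x - of_nat j) / of_nat (Suc j)" for j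
    using gbinomial_mult_1[of x j] by (simp add: field_simps del: of_nat_Suc)
  from this[of "pred_numeral k"] show ?thesis
    by (simp only: numeral_eq_Suc[symmetric] of_nat_numeral) 
qed

text \<open>In the application \<open>a\<close> and \<open>k\<close> are numerals and \<open>b\<close> grows with the weight. Here \<open>b\<close> no longer
  occurs as a lower index, so up to the sign \<open>(-1)\<^sup>b\<close> the right-hand side is a polynomial in \<open>b\<close>.\<close>

lemma outer_weight_eq:
  assumes "k \<ge> 1"
  shows "outer_weight a b k = (- of_nat k gchoose a) * (of_nat b + of_nat (a + 1 + k) gchoose (a + 1 + k))
     + (-1) ^ b * (of_nat b + of_nat (a + 1 + k) gchoose a) * (of_nat b + of_nat (k - 1) gchoose (k - 1))"
proof -
  have sym: "(of_nat b + of_nat m gchoose b :: complex) = (of_nat b + of_nat m gchoose m)" for m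
    using binomial_symmetric[of b "b + m"] by (simp flip: of_nat_add binomial_gbinomial)
  have "(- of_nat k gchoose b :: complex) = (-1) ^ b * (of_nat k + of_nat b - 1 gchoose b)"
    by (rule gbinomial_minus)
  also have "(of_nat k + of_nat b - 1 :: complex) = of_nat b + of_nat (k - 1)"
    using assms by (simp add: of_nat_diff)
  finally have "(- of_nat k gchoose b :: complex) = (-1) ^ b * (of_nat b + of_nat (k - 1) gchoose (k - 1))"
    by (simp only: sym)
  moreover have "of_nat (a + b + 1 + k) = (of_nat b + of_nat (a + 1 + k) :: complex)" by simp
  ultimately show ?thesis
    unfolding outer_weight_def using sym[of "a + 1 + k"] by (simp only: mult_ac)
qed

lemma X_eval:
  fixes N :: nat
  assumes "a + b = int N" "b \<ge> 2"
  shows "X a b = chi (of_nat N - 4) b * X (int N - 2) 2"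
  using chi_closed_form[of X b a "int N", OF X_shift] assms by simp

lemma B_eval:
  fixes N :: nat
  assumes "a + b + c = int N" "a \<ge> 3" "b \<ge> 2" "c \<ge> 2"
  shows "B a b c = (of_int (b - a) * chi (of_nat N - 4) c * X (int N - 2) 2
     + of_int (b - c) * chi (of_nat N - 4) (b + c) * X (int N - 2) 2
     + of_int (a - c) * chi (of_nat N - 4) b * X (int N - 2) 2
     + (if b = 2 then chi (of_nat N - 6) c * Y (int N - 4) 2 else 0)
     - (if c = 2 then chi (of_nat N - 6) b * Y (int N - 4) 2 else 0)) / 2"
proof -
  have Y: "Y x y = chi (of_nat N - 6) y * Y (int N - 4) 2" if "x + y = int N - 2" "y \<ge> 2" for x y
    using chi_closed_form[of Y y x "int N - 2", OF Y_shift] that by simp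
  show ?thesis
    using B_formula[OF assms(2-4)] X_eval[of "a + b" c N] X_eval[of a "b + c" N] X_eval[of "a + c" b N]
      Y[of a c] Y[of a b] assms by (auto simp: mult.assoc mult.commute[of _ "2 :: complex"])
qed

lemma chi_numeral:
  "chi t 2 = 1" "chi t 3 = - t" "chi t 4 = t * (t - 1) / 2" "chi t 5 = - (t * (t - 1) * (t - 2) / 6)"
  "chi t 6 = t * (t - 1) * (t - 2) * (t - 3) / 24" "chi t 7 = - (t * (t - 1) * (t - 2) * (t - 3) * (t - 4) / 120)"
  "chi t 8 = t * (t - 1) * (t - 2) * (t - 3) * (t - 4) * (t - 5) / 720"
  "chi t 9 = - (t * (t - 1) * (t - 2) * (t - 3) * (t - 4) * (t - 5) * (t - 6) / 5040)"
  "chi t 10 = t * (t - 1) * (t - 2) * (t - 3) * (t - 4) * (t - 5) * (t - 6) * (t - 7) / 40320"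
  "chi t 11 = - (t * (t - 1) * (t - 2) * (t - 3) * (t - 4) * (t - 5) * (t - 6) * (t - 7) * (t - 8) / 362880)"
  by (simp_all add: chi_def gbinomial_numeral)

lemma gbinomial_numerals:
  fixes x :: complex
  shows "x gchoose 2 = x * (x - 1) / 2" "x gchoose 3 = x * (x - 1) * (x - 2) / 6"
  "x gchoose 4 = x * (x - 1) * (x - 2) * (x - 3) / 24" "x gchoose 5 = x * (x - 1) * (x - 2) * (x - 3) * (x - 4) / 120"
  "x gchoose 6 = x * (x - 1) * (x - 2) * (x - 3) * (x - 4) * (x - 5) / 720"
  "x gchoose 7 = x * (x - 1) * (x - 2) * (x - 3) * (x - 4) * (x - 5) * (x - 6) / 5040"
  "x gchoose 8 = x * (x - 1) * (x - 2) * (x - 3) * (x - 4) * (x - 5) * (x - 6) * (x - 7) / 40320"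
  by (simp_all add: gbinomial_numeral)

text \<open>The next two facts are needed as the simplifier writes \<open>1\<close>, and the sums of \<open>1\<close> and \<open>k\<close> for small
  \<open>k\<close>, with \<open>Suc\<close>.\<close>

lemmas gbinomial_Suc_numerals =
  gbinomial_numerals(1)[unfolded numeral_2_eq_2] gbinomial_numerals(2)[unfolded numeral_3_eq_3]

lemma outer_weight_1: "outer_weight a b (Suc 0) = (- 1 gchoose a) * (of_nat b + of_nat (a + 2) gchoose (a + 2))
     + (-1) ^ b * (of_nat b + of_nat (a + 2) gchoose a)"
  using outer_weight_eq[of 1 a b] by simp

section \<open>The circuit of four relations\<close>

context
  fixes N :: nat and n z s :: complex
  assumes N: "even N" "N \<ge> 18"
    and n: "n = of_nat N" and z: "z = X (int N - 2) 2" and s: "s = Y (int N - 4) 2"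
begin

lemma N_ge: "m \<le> 18 \<Longrightarrow> m \<le> N" "k \<le> 18 \<Longrightarrow> k \<le> int N"
  using N(2) by auto

lemma parity: "(-1) ^ (N - 13) = (-1 :: complex)" "(-1) ^ (N - 12) = (1 :: complex)"
  using N by simp_all

lemma of_nat_N: "of_nat N = n" "int (N - 13) = int N - 13" "int (N - 12) = int N - 12"
   "of_nat (N - 13) = n - 13" "of_nat (N - 12) = n - 12"
  using N(2) by (simp_all add: n of_nat_diff)

lemma X_value: "a + b = int N \<Longrightarrow> b \<ge> 2 \<Longrightarrow> X a b = chi (n - 4) b * z"
  using X_eval[of a b N] by (simp add: n z)

lemma B_value: "a + b + c = int N \<Longrightarrow> a \<ge> 3 \<Longrightarrow> b \<ge> 2 \<Longrightarrow> c \<ge> 2 \<Longrightarrow>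
  B a b c = (of_int (b - a) * chi (n - 4) c * z + of_int (b - c) * chi (n - 4) (b + c) * z
     + of_int (a - c) * chi (n - 4) b * z + (if b = 2 then chi (n - 6) c * s else 0)
     - (if c = 2 then chi (n - 6) b * s else 0)) / 2"
  using B_eval[of a b c N] by (simp add: n z s)

lemmas evaluation = N_ge parity of_nat_N X_value B_value A_sort[of _ 4] A_sort[of _ 5]
  outer_weight_1 outer_weight_eq gbinomial_numerals gbinomial_Suc_numerals chi_numeral

lemma atLeastAtMost_numeral:
  "{1..5} = {1, 2, 3, 4, 5 :: nat}" "{1..6} = {1, 2, 3, 4, 5, 6 :: nat}" "{1..7} = {1, 2, 3, 4, 5, 6, 7 :: nat}"
  by auto

text \<open>The four edges of the circuit. The edge along which a small index \<open>i\<close> becomes \<open>i + 1\<close> while \<open>p\<close> and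
  \<open>q\<close> stay is \<open>A_product\<close> with \<open>a = i - 2\<close>; then \<open>b\<close> is determined by the weight \<open>N\<close>, and the parity of \<open>N\<close>
  gives the sign \<open>(-1)\<^sup>b\<close> in the outer weights. After evaluation, the two sides of each edge differ by the
  left-hand side of \<open>raw\<close>, as polynomials in \<open>n\<close>.\<close>

lemma A_533_433:
  "6 * A (int N - 11) 5 3 3 + 2 * (n - 12) * A (int N - 10) 4 3 3
    = n * (n - 2) * (n - 4) * (n - 15) * (293 * n^5 - 12927 * n^4 + 223973 * n^3 - 1904337 * n^2 + 7950686 * n - 13074648) / 60480 * z
      - (n - 4) * (n - 6) * (n - 7) * (n - 8) * (n - 11) * (n - 12) * (n - 15) / 30 * s
      - n * (n - 4) * (n - 5) * (n - 6) * (n - 9) * (n - 10) * (n - 11) * (n - 12) * (n - 15) / 672 * central_charge * z"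
proof -
  note [simp] = evaluation
  note raw = A_product[where a = 2 and b = "N - 13" and p = 3 and q = 3 and R = 5,
      unfolded atLeastAtMost_numeral, simplified]
  show ?thesis
    by (rule iffD1[OF right_minus_eq], rule trans[OF _ raw]) (simp add: field_simps power_numeral_reduce)
qed

lemma A_533_532:
  "2 * A (int N - 11) 5 3 3 + 2 * (n - 12) * A (int N - 10) 5 3 2
    = n * (n - 2) * (n - 4) * (n - 6) * (n - 13) * (39 * n^4 - 1469 * n^3 + 20605 * n^2 - 128331 * n + 301908) / 20160 * z
      - (n - 4) * (n - 6) * (n - 11) * (n - 12) * (n - 13) * (13 * n^2 - 221 * n + 990) / 720 * s
      - n * (n - 4) * (n - 9) * (n - 10) * (n - 11) * (n - 12) * (n - 13) * (43 * n^2 - 559 * n + 1846) / 60480 * central_charge * z"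
proof -
  note [simp] = evaluation
  note raw = A_product[where a = 0 and b = "N - 13" and p = 3 and q = 5 and R = 7,
      unfolded atLeastAtMost_numeral, simplified]
  show ?thesis
    by (rule iffD1[OF right_minus_eq], rule trans[OF _ raw]) (simp add: field_simps power_numeral_reduce)
qed

lemma A_532_432:
  "6 * A (int N - 10) 5 3 2 + 2 * (n - 11) * A (int N - 9) 4 3 2
    = n * (n - 2) * (n - 4) * (n - 11) * (5 * n^4 - 187 * n^3 + 2625 * n^2 - 15829 * n + 33546) / 3360 * z
      - (n - 4) * (n - 6) * (n - 7) * (n - 11) * (n^2 - 23 * n + 150) / 120 * s
      - n * (n - 4) * (n - 5) * (n - 9) * (n - 10) * (n - 11) * (n^2 - 21 * n + 146) / 4032 * central_charge * z"
proof -
  note [simp] = evaluation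
  note raw = A_product[where a = 2 and b = "N - 12" and p = 2 and q = 3 and R = 5,
      unfolded atLeastAtMost_numeral, simplified]
  show ?thesis
    by (rule iffD1[OF right_minus_eq], rule trans[OF _ raw]) (simp add: field_simps power_numeral_reduce)
qed

lemma A_433_432:
  "2 * A (int N - 10) 4 3 3 + 2 * (n - 11) * A (int N - 9) 4 3 2
    = - n * (n - 2) * (n - 4) * (n - 11) * (8 * n^4 - 281 * n^3 + 3934 * n^2 - 25759 * n + 63930) / 5040 * z
      + (n - 4) * (n - 6) * (n - 11) * (n^3 - 30 * n^2 + 331 * n - 1350) / 80 * s
      + n * (n - 4) * (n - 8) * (n - 9) * (n - 10) * (n - 11) * (n^2 - 18 * n + 107) / 2520 * central_charge * z"
proof -
  note [simp] = evaluation
  note raw = A_product[where a = 0 and b = "N - 12" and p = 3 and q = 4 and R = 6,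
      unfolded atLeastAtMost_numeral, simplified]
  show ?thesis
    by (rule iffD1[OF right_minus_eq], rule trans[OF _ raw]) (simp add: field_simps power_numeral_reduce)
qed

text \<open>In the combination of the four relations that removes the values of \<open>A\<close>, the terms with
  \<open>s\<close> and with the central charge cancel identically in \<open>n\<close>. The roots of the remaining coefficient are the
  even numbers from \<open>0\<close> to \<open>16\<close>.\<close>

lemma X_even_eq_0: "z = 0"
proof -
  have eliminate: "P1 - 3 * P2 + (n - 12) * (P3 - P4) = 0"
    if "6 * t + 2 * (n - 12) * v = P1" "2 * t + 2 * (n - 12) * w = P2"
      "6 * w + 2 * (n - 11) * u = P3" "2 * v + 2 * (n - 11) * u = P4" for t u v w P1 P2 P3 P4 :: complex
    unfolding that[symmetric] by (simp add: algebra_simps)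
  have "2 / 945 * (n * (n - 2) * (n - 4) * (n - 6) * (n - 8) * (n - 10) * (n - 12) * (n - 14) * (n - 16)) * z = 0"
    by (rule trans[OF _ eliminate[OF A_533_433 A_533_532 A_532_432 A_433_432]]) (simp add: field_simps power_numeral_reduce)
  moreover have "n \<noteq> of_nat k" if "k < 18" for k
    using N(2) that by (simp add: n)
  from this[of 0] this[of 2] this[of 4] this[of 6] this[of 8] this[of 10] this[of 12] this[of 14] this[of 16]
  have "n * (n - 2) * (n - 4) * (n - 6) * (n - 8) * (n - 10) * (n - 12) * (n - 14) * (n - 16) \<noteq> 0"
    by simp
  ultimately show ?thesis by simp
qed

end

text \<open>For odd \<open>N\<close>, walking from \<open>X (N - 2) 2\<close> to \<open>X 2 (N - 2)\<close> by \<open>X_shift\<close> produces the factor \<open>-1\<close>,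
  whereas \<open>X\<close> is symmetric.\<close>

lemma X_eq_0:
  assumes "N \<ge> 18"
  shows "X (int N - 2) 2 = 0"
proof (cases "even N")
  case True
  then show ?thesis using X_even_eq_0[OF _ assms refl refl refl] by simp
next
  case False
  define k where "k = N - 4"
  then have k: "N = k + 4" using assms by simp
  have "X 2 (int N - 2) = chi (of_int (int N) - 4) (int N - 2) * X (int N - 2) 2"
    using assms by (intro chi_closed_form X_shift) auto
  also have "chi (of_int (int N) - 4) (int N - 2) = -1"
  proof -
    have "nat (int N - 2 - 2) = k" using k by simp
    moreover have "of_int (int N) - 4 = (of_nat k :: complex)" by (simp add: k)
    moreover have "odd k" using False k by simp
    ultimately show ?thesis
      by (simp add: chi_def flip: binomial_gbinomial)
  qed
  finally show ?thesis by (simp add: X_commute[of 2])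
qed

section \<open>Vanishing of the classes and finite dimension\<close>

lemma \<psi>_eta_eq_0:
  assumes "n \<ge> 16"
  shows "\<psi> (eta vac (virasoro prd \<omega> (- n) \<omega>)) = 0"
proof -
  have "\<psi> (eta vac (virasoro prd \<omega> (- n) \<omega>)) = Phi (K n (Kv 2)) vac"
    by (simp add: eta_def Phi_def Kv_2) (simp add: K_def)
  also have "\<dots> = - X n 2"
    using assms by (simp add: Phi_K X_def Phi_commute)
  also have "X n 2 = 0"
    using X_eq_0[of "nat (n + 2)"] assms by simp
  finally show ?thesis by simp
qed

end

lemma (in vertex_operator_algebra) eta_in_fixed_C2:
  assumes "n \<ge> 16"
  shows "eta vac (virasoro prd \<omega> (- n) \<omega>) \<in> fixed_C2 prd"
proof (rule ccontr)
  assume "eta vac (virasoro prd \<omega> (- n) \<omega>) \<notin> fixed_C2 prd"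
  then obtain \<psi> :: "('a, 'a) tensor \<Rightarrow> complex" where \<psi>: "clinear \<psi>" "\<forall>y\<in>fixed_C2 prd. \<psi> y = 0"
      "\<psi> (eta vac (virasoro prd \<omega> (- n) \<omega>)) = 1"
    unfolding C2_def using clinear_functional_separating by blast
  interpret C2_functional prd vac \<omega> grade central_charge \<psi>
    by (intro C2_functional.intro C2_functional_axioms.intro vertex_operator_algebra_axioms)
       (use \<psi> in auto)
  show False using \<psi>_eta_eq_0[OF assms] \<psi>(3) by simp
qed

text \<open>\<open>C\<close> is the zero vector of the quotient, so it belongs to every subspace.\<close>

lemma quot_span_insert_zero:
  assumes "B \<subseteq> S" "S \<subseteq> insert C B"
  shows "quot_span W C S = quot_span W C B"
proof -
  have "{t. quot_subspace W C t \<and> S \<subseteq> t} = {t. quot_subspace W C t \<and> B \<subseteq> t}"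
    using assms by (auto simp: quot_subspace_def)
  then show ?thesis by (simp add: quot_span_def hull_def)
qed

theorem theorem5p5:
  fixes prd :: "'a::complex_vector \<Rightarrow> int \<Rightarrow> 'a \<Rightarrow> 'a"
    and vac \<omega> :: 'a
    and grade :: "nat \<Rightarrow> 'a set"
    and c :: complex
  assumes "cft_type_voa prd vac \<omega> grade c"
  shows "(\<forall>n::int. n \<ge> 30 \<longrightarrow> eta_bar prd vac (virasoro prd \<omega> (- n) \<omega>) = fixed_C2 prd) \<and>
    quot_finite_dimensional fixed_subalgebra (fixed_C2 prd)
      (quot_span fixed_subalgebra (fixed_C2 prd)
        {eta_bar prd vac (virasoro prd \<omega> (- n) \<omega>) | n::int. n \<ge> 2})"
proof -
  interpret cft_type_voa prd vac \<omega> grade c by (rule assms)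
  let ?e = "\<lambda>n. eta_bar prd vac (virasoro prd \<omega> (- n) \<omega>)"
  let ?S = "{?e n | n::int. n \<ge> 2}"
  let ?B = "?e ` {2..<30}"
  have vanish: "?e n = fixed_C2 prd" if "n \<ge> 30" for n
  proof -
    have C: "cvec.subspace (fixed_C2 prd)" by (simp add: C2_def cvec.subspace_span)
    have "?e n = 0 +o fixed_C2 prd"
      unfolding eta_bar_def coset_eq_iff[OF C] using eta_in_fixed_C2[of n] that by simp
    then show ?thesis by simp
  qed
  have "?B \<subseteq> ?S" by auto
  moreover have "?S \<subseteq> insert (fixed_C2 prd) ?B"
  proof
    fix x assume "x \<in> ?S"
    then obtain n where "x = ?e n" "n \<ge> 2" by blast
    then show "x \<in> insert (fixed_C2 prd) ?B" by (cases "n < 30") (auto simp: vanish)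
  qed
  ultimately have span: "quot_span fixed_subalgebra (fixed_C2 prd) ?S = quot_span fixed_subalgebra (fixed_C2 prd) ?B"
    by (rule quot_span_insert_zero)
  have "?B \<subseteq> quot_span fixed_subalgebra (fixed_C2 prd) ?S"
    unfolding span unfolding quot_span_def by (rule hull_subset)
  then have "quot_finite_dimensional fixed_subalgebra (fixed_C2 prd)
      (quot_span fixed_subalgebra (fixed_C2 prd) ?S)"
    unfolding quot_finite_dimensional_def using span by (intro exI[of _ ?B]) simp
  with vanish show ?thesis by blast
qed

end
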